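(* Assume $\Omega \subset \mathbb{R}^d$ is open and nonempty, take $1 \leq p < \infty$, and suppose $\psi \in L^p(\mathbb{R}^d)$ is compactly supported with $\int_{\mathbb{R}^d} \psi \, dx = 1$. Then for all $f \in L^p(\Omega)$, $$\| f \|_{L^p(\Omega)} \approx \inf \left\{ \| c \|_{\ell^1(\ell^p)} : c\in\ell^1(\ell^p),\ f = Sc, \text{ and } c \text{ is adapted to } \Omega \text{ and } \psi \right\},$$ i.e. each side is bounded by a positive constant, independent of $f$, times the other. Here $f=Sc$ is understood with the series $Sc=\sum_{j>0}\sum_{k\in\mathbb{Z}^d} c_{j,k}\psi_{j,k}$ converging in the sense that the sum over $k$ converges pointwise absolutely a.e. to a function in $L^p$ and the sum over $j$ converges absolutely in $L^p$.
   Context: Fix $d \in \mathbb{N}$. The dilation matrices $a_j$ ($j=1,2,3,\ldots$) are invertible $d \times d$ real matrices that are expanding: $\|a_j^{-1}\| \to 0$ as $j \to \infty$ (operator norm on $\mathbb{R}^d$). The translation matrix $b$ is an invertible $d \times d$ real matrix. $L^p=L^p(\mathbb{R}^d)$ consists of complex-valued functions; functions in $L^p(\Omega)$ are regarded as functions on $\mathbb{R}^d$ vanishing outside $\Omega$. Sums over $j>0$ are over $j=1,2,3,\ldots$. For $\psi \in L^p$ put $\psi_{j,k}(x) = |\det a_j|^{1/p}\psi(a_j x - bk)$, $x \in \mathbb{R}^d$, $k \in \mathbb{Z}^d$. The synthesis operator is $Sc=\sum_{j>0}\sum_{k\in\mathbb{Z}^d}c_{j,k}\psi_{j,k}$. For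 sequences $c=\{c_{j,k}\}_{j>0,k\in\mathbb{Z}^d}$ of complex numbers, $\|c\|_{\ell^1(\ell^p)} = \sum_{j>0} \big(\sum_{k\in\mathbb{Z}^d}|c_{j,k}|^p\big)^{1/p}$, and $\ell^1(\ell^p)$ is the Banach space of sequences with finite norm. A sequence $c=\{c_{j,k}\}$ is adapted to $\Omega$ and $\psi$ if $\operatorname{spt}(\psi_{j,k})\subset\Omega$ whenever $c_{j,k}\neq 0$ (equivalently $c_{j,k}=0$ whenever $\operatorname{spt}(\psi_{j,k})\cap\Omega^c\neq\emptyset$), where $\operatorname{spt}$ denotes support. (Then $Sc=0$ on $\Omega^c$.) *)

theory Defs
  imports "HOL-Analysis.Analysis"
begin

text \<open>Elements of \<open>L\<^sup>p\<close> are represented by Lebesgue measurable functions, taken up to equality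
  almost everywhere. A function in \<open>L\<^sup>p(\<Omega>)\<close> is defined on the whole space and vanishes outside
  \<open>\<Omega>\<close>, again almost everywhere.\<close>

definition Lp :: "real \<Rightarrow> (real ^ 'd) set \<Rightarrow> (real ^ 'd \<Rightarrow> complex) set" where
  "Lp p \<Omega> = {f. f \<in> borel_measurable lebesgue \<and>
                integrable lebesgue (\<lambda>x. norm (f x) powr p) \<and>
                (AE x in lebesgue. x \<notin> \<Omega> \<longrightarrow> f x = 0)}"

definition Lp_norm :: "real \<Rightarrow> (real ^ 'd) set \<Rightarrow> (real ^ 'd \<Rightarrow> complex) \<Rightarrow> real" where
  "Lp_norm p \<Omega> f = (LINT x:\<Omega>|lebesgue. norm (f x) powr p) powr (1 / p)"

text \<open>The support of an \<open>L\<^sup>p\<close> function must not depend on the representative, so it is the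
  complement of the largest open set on which the function vanishes almost everywhere.\<close>

definition spt :: "(real ^ 'd \<Rightarrow> complex) \<Rightarrow> (real ^ 'd) set" where
  "spt f = - \<Union> {U. open U \<and> (AE x in lebesgue. x \<in> U \<longrightarrow> f x = 0)}"

text \<open>The lattice of integer vectors is the type \<^typ>\<open>int ^ 'd\<close>, embedded by \<open>int_vec\<close>.\<close>

definition int_vec :: "int ^ 'd \<Rightarrow> real ^ 'd" where
  "int_vec k = (\<chi> i. real_of_int (k $ i))"

definition affine_fun ::
  "(nat \<Rightarrow> real ^ 'd ^ 'd) \<Rightarrow> real ^ 'd ^ 'd \<Rightarrow> real \<Rightarrow> (real ^ 'd \<Rightarrow> complex)
    \<Rightarrow> nat \<Rightarrow> int ^ 'd \<Rightarrow> real ^ 'd \<Rightarrow> complex" where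
  "affine_fun a b p \<psi> j k x =
     complex_of_real (\<bar>det (a j)\<bar> powr (1 / p)) * \<psi> (a j *v x - b *v int_vec k)"

text \<open>Sequences \<open>c j k\<close> are indexed by \<open>j \<ge> 1\<close>; the values \<open>c 0 k\<close> are never used.\<close>

definition l1lp :: "real \<Rightarrow> (nat \<Rightarrow> int ^ 'd \<Rightarrow> complex) set" where
  "l1lp p = {c. (\<forall>j\<ge>1. (\<lambda>k. norm (c j k) powr p) summable_on UNIV) \<and>
                (\<lambda>j. (\<Sum>\<^sub>\<infinity>k. norm (c j k) powr p) powr (1 / p)) summable_on {1..}}"

definition l1lp_norm :: "real \<Rightarrow> (nat \<Rightarrow> int ^ 'd \<Rightarrow> complex) \<Rightarrow> real" where
  "l1lp_norm p c = (\<Sum>\<^sub>\<infinity>j\<in>{1..}. (\<Sum>\<^sub>\<infinity>k. norm (c j k) powr p) powr (1 / p))"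

definition adapted ::
  "(nat \<Rightarrow> real ^ 'd ^ 'd) \<Rightarrow> real ^ 'd ^ 'd \<Rightarrow> real \<Rightarrow> (real ^ 'd \<Rightarrow> complex) \<Rightarrow> (real ^ 'd) set
    \<Rightarrow> (nat \<Rightarrow> int ^ 'd \<Rightarrow> complex) \<Rightarrow> bool" where
  "adapted a b p \<psi> \<Omega> c \<longleftrightarrow>
     (\<forall>j\<ge>1. \<forall>k. c j k \<noteq> 0 \<longrightarrow> spt (affine_fun a b p \<psi> j k) \<subseteq> \<Omega>)"

definition scale_sum ::
  "(nat \<Rightarrow> real ^ 'd ^ 'd) \<Rightarrow> real ^ 'd ^ 'd \<Rightarrow> real \<Rightarrow> (real ^ 'd \<Rightarrow> complex)
    \<Rightarrow> (nat \<Rightarrow> int ^ 'd \<Rightarrow> complex) \<Rightarrow> nat \<Rightarrow> real ^ 'd \<Rightarrow> complex" where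
  "scale_sum a b p \<psi> c j x = (\<Sum>\<^sub>\<infinity>k. c j k * affine_fun a b p \<psi> j k x)"

text \<open>The relation \<open>f = Sc\<close>, with its mode of convergence: for each \<open>j\<close> the sum over \<open>k\<close> converges
  absolutely at almost every point to a function in \<open>L\<^sup>p\<close>, and the sum over \<open>j\<close> converges
  absolutely in \<open>L\<^sup>p\<close>, to \<open>f\<close>.\<close>

definition is_synthesis ::
  "(nat \<Rightarrow> real ^ 'd ^ 'd) \<Rightarrow> real ^ 'd ^ 'd \<Rightarrow> real \<Rightarrow> (real ^ 'd \<Rightarrow> complex)
    \<Rightarrow> (nat \<Rightarrow> int ^ 'd \<Rightarrow> complex) \<Rightarrow> (real ^ 'd \<Rightarrow> complex) \<Rightarrow> bool" where
  "is_synthesis a b p \<psi> c f \<longleftrightarrow>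
     f \<in> Lp p UNIV \<and>
     (\<forall>j\<ge>1. (AE x in lebesgue. (\<lambda>k. norm (c j k * affine_fun a b p \<psi> j k x)) summable_on UNIV) \<and>
            scale_sum a b p \<psi> c j \<in> Lp p UNIV) \<and>
     (\<lambda>j. Lp_norm p UNIV (scale_sum a b p \<psi> c j)) summable_on {1..} \<and>
     (\<lambda>J. Lp_norm p UNIV (\<lambda>x. f x - (\<Sum>j=1..J. scale_sum a b p \<psi> c j x))) \<longlonglongrightarrow> 0"

end

theory Submission
  imports Defs
begin

text \<open>The lower estimate is Minkowski's inequality together with the fact that at each scale only
  boundedly many translates of \<open>\<psi>\<close> overlap.

  For the upper estimate, let \<open>M\<^sub>j = b\<^sup>-\<^sup>1 a\<^sub>j\<close> and \<open>\<phi>(y) = \<bar>det b\<bar> \<psi>(b y)\<close>, and let \<open>\<Phi>\<close> be the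
  \<open>\<int>\<^sup>d\<close>-periodization of \<open>\<phi>\<close>, which has mean one. For \<open>f\<close> continuous with compact support in \<open>\<Omega>\<close>, sampling \<open>t f\<close> at the points
  \<open>M\<^sub>j\<^sup>-\<^sup>1 k\<close> gives an adapted sequence at the single scale \<open>j\<close> whose synthesis is close to
  \<open>t f(x) \<Phi>(M\<^sub>j x)\<close>. Hence for large \<open>j\<close> the residual has norm close to \<open>\<parallel>f\<parallel>\<^sub>p\<close> times the \<open>L\<^sup>p\<close> norm
  of \<open>1 - t \<Phi>\<close> on a period, and the latter is less than one for small \<open>t > 0\<close>. By density every
  \<open>f\<close> in \<open>L\<^sup>p(\<Omega>)\<close> admits such a contracting step at arbitrarily large scales; iterating along
  increasing scales writes \<open>f\<close> as a synthesis with geometrically decaying coefficients.\<close>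

subsection \<open>Linear change of variables\<close>

text \<open>The obstacle is that \<open>\<psi>\<close> is merely in L^p, and its translates need not
  add up to a constant. Subtracting a full sample (t = 1) may therefore enlarge the residual. Only
  the mean is known, and what sees it is the derivative at t = 0 of the p-th power integral of 1 - t
  \<Phi>, which equals -p.

  The contraction factor must depend neither on the function nor on the scale. It comes from an
  exact identity, not from a limit: a function constant on the cells of the lattice, times a
  function of the position within the cell, has as L^p norm the product of the first norm and the
  norm of the second over one period. Only the sampling error depends on the function, and a large
  scale makes it small.

  A residual is again only in L^p, so each step begins with a fresh continuous approximation whose
  error is a fixed fraction of the current norm. Adapted coefficients keep the residual zero outside
  \<Omega>, which allows the step to be repeated, and strictly increasing scales give each step its
  own row of coefficients.\<close>

lemma measure_linear_image_from_cboxes: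
  fixes f :: "real ^ 'd \<Rightarrow> real ^ 'd"
  assumes "linear f" "\<And>u v. measure lebesgue (f ` cbox u v) = m * measure lebesgue (cbox u v)"
    and "S \<in> lmeasurable"
  shows "f ` S \<in> lmeasurable" "measure lebesgue (f ` S) = m * measure lebesgue S"
  using measure_linear_sufficient[OF assms(1,3,2)] by auto

lemma det_shear:
  fixes m n :: "'d::finite"
  assumes "m \<noteq> n"
  shows "det (matrix (\<lambda>x::real^'d. \<chi> i. if i = m then x$m + x$n else x$i)) = 1"
proof -
  have "matrix (\<lambda>x::real^'d. \<chi> i. if i = m then x$m + x$n else x$i) =
      (\<chi> k. if k = m then row m (mat 1) + 1 *s row n (mat 1) else row k (mat 1))"
    by (auto simp: vec_eq_iff matrix_def row_def mat_def axis_def)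
  then show ?thesis
    using det_row_operation[OF assms, of "mat 1 :: real^'d^'d" 1] by simp
qed

text \<open>A linear shear takes translates to translates, so the lower corner may be moved to the
  origin, where the sign condition of \<open>measure_shear_interval\<close> on the
  \<open>n\<close>-th coordinate holds.\<close>

lemma measure_shear_cbox:
  fixes u v :: "real ^ 'd"
  assumes "m \<noteq> n"
  shows "measure lebesgue ((\<lambda>x. \<chi> i. if i = m then x$m + x$n else x$i) ` cbox u v) = measure lebesgue (cbox u v)"
    (is "measure _ (?h ` _) = _")
proof (cases "cbox u v = {}")
  case False
  have eq: "cbox u v = (+) u ` cbox 0 (v - u)"
    using cbox_translation[of u 0 "v - u"] by simp
  have lin: "?h (x + y) = ?h x + ?h y" for x y
    by (simp add: vec_eq_iff)
  have "?h ` cbox u v = (+) (?h u) ` ?h ` cbox 0 (v - u)"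
    unfolding eq image_image lin ..
  moreover have "cbox 0 (v - u) \<noteq> {}"
    using False eq by auto
  ultimately show ?thesis
    using measure_shear_interval[OF assms, of 0 "v - u"]
    by (simp add: measure_translation eq)
qed simp

lemma cbox_permuted_image:
  fixes u v :: "real ^ 'd"
  assumes "\<And>i. \<sigma> (\<sigma> i) = i"
  shows "(\<lambda>x. \<chi> i. x $ \<sigma> i) ` cbox u v = cbox (\<chi> i. u $ \<sigma> i) (\<chi> i. v $ \<sigma> i)"
proof -
  have "x \<in> (\<lambda>x. \<chi> i. x $ \<sigma> i) ` cbox u v" if "x \<in> cbox (\<chi> i. u $ \<sigma> i) (\<chi> i. v $ \<sigma> i)" for x
  proof (rule image_eqI)
    show "x = (\<chi> i. (\<chi> j. x $ \<sigma> j) $ \<sigma> i)"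
      by (simp add: vec_eq_iff assms)
    show "(\<chi> j. x $ \<sigma> j) \<in> cbox u v"
      using that assms by (simp add: mem_box_cart) metis
  qed
  then show ?thesis
    by (auto simp: mem_box_cart)
qed

text \<open>The change of variables theory of the library needs a well-ordered index type, whereas
  \<open>'d\<close> is only finite.\<close>

proposition measure_linear_image_cbox:
  fixes f :: "real ^ 'd \<Rightarrow> real ^ 'd"
  assumes "linear f"
  shows "measure lebesgue (f ` cbox u v) = \<bar>det (matrix f)\<bar> * measure lebesgue (cbox u v)"
proof -
  have "\<forall>u v. measure lebesgue (f ` cbox u v) = \<bar>det (matrix f)\<bar> * measure lebesgue (cbox u v)"
  \<comment> \<open>Every linear map is a composition of maps killing a coordinate, diagonal
    scalings, coordinate swaps and shears, and both sides multiply under composition.\<close>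
  proof (rule induct_linear_elementary[OF assms]; intro allI)
    fix f g :: "real ^ 'd \<Rightarrow> real ^ 'd" and u v
    assume *: "linear f" "linear g"
      "\<forall>u v. measure lebesgue (f ` cbox u v) = \<bar>det (matrix f)\<bar> * measure lebesgue (cbox u v)"
      "\<forall>u v. measure lebesgue (g ` cbox u v) = \<bar>det (matrix g)\<bar> * measure lebesgue (cbox u v)"
    \<comment> \<open>The image of a box under \<open>g\<close> is no longer a box, so the
      hypothesis on \<open>f\<close> is first extended to all sets of finite measure.\<close>
    then show "measure lebesgue ((f \<circ> g) ` cbox u v) = \<bar>det (matrix (f \<circ> g))\<bar> * measure lebesgue (cbox u v)"
      using measure_linear_image_from_cboxes(2)[OF *(1), of "\<bar>det (matrix f)\<bar>" "g ` cbox u v"]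
      by (simp add: o_def image_image measurable_linear_image_interval matrix_compose[unfolded o_def] det_mul abs_mult)
  next
    fix f :: "real ^ 'd \<Rightarrow> real ^ 'd" and i u v
    assume f: "linear f" "\<And>x. f x $ i = 0"
    \<comment> \<open>Both sides vanish: the image lies in a coordinate hyperplane and the matrix
      has a zero row.\<close>
    have "negligible (f ` cbox u v)"
      by (rule negligible_subset[OF negligible_standard_hyperplane_cart[of i]]) (auto simp: f)
    moreover have "row i (matrix f) = 0"
      by (simp add: vec_eq_iff row_def matrix_def f)
    ultimately show "measure lebesgue (f ` cbox u v) = \<bar>det (matrix f)\<bar> * measure lebesgue (cbox u v)"
      by (simp add: negligible_imp_measure0 det_zero_row(1)[where i=i])
  next
    fix c :: "'d \<Rightarrow> real" and u v :: "real ^ 'd"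
    have "matrix (\<lambda>x. \<chi> i. c i * x $ i) = (\<chi> i j. if i = j then c i else 0)"
      by (auto simp: matrix_def axis_def vec_eq_iff)
    then have "det (matrix (\<lambda>x. \<chi> i. c i * x $ i)) = prod c UNIV"
      by (simp add: det_diagonal)
    then show "measure lebesgue ((\<lambda>x. \<chi> i. c i * x $ i) ` cbox u v)
        = \<bar>det (matrix (\<lambda>x. \<chi> i. c i * x $ i))\<bar> * measure lebesgue (cbox u v)"
      by (simp add: measure_stretch)
  next
    fix m n :: 'd and u v :: "real ^ 'd"
    let ?s = "Transposition.transpose m n"
    have "matrix (\<lambda>x::real^'d. \<chi> i. x $ ?s i) = (\<chi> i. mat 1 $ ?s i)"
      by (auto simp: matrix_def axis_def mat_def vec_eq_iff)
    then have "\<bar>det (matrix (\<lambda>x::real^'d. \<chi> i. x $ ?s i))\<bar> = 1"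
      by (simp add: det_permute_rows permutes_swap_id sign_swap_id)
    moreover have "(\<Prod>i\<in>UNIV. v $ ?s i - u $ ?s i) = (\<Prod>i\<in>UNIV. v $ i - u $ i)"
      by (rule prod.reindex_bij_betw) simp
    moreover have "cbox (\<chi> i. u $ ?s i) (\<chi> i. v $ ?s i) = {} \<longleftrightarrow> cbox u v = {}"
      using cbox_permuted_image[of ?s u v] by (metis image_is_empty transpose_involutory)
    ultimately show "measure lebesgue ((\<lambda>x. \<chi> i. x $ ?s i) ` cbox u v)
        = \<bar>det (matrix (\<lambda>x::real^'d. \<chi> i. x $ ?s i))\<bar> * measure lebesgue (cbox u v)"
      by (simp add: cbox_permuted_image content_cbox_if_cart)
  next
    fix m n :: 'd and u v :: "real ^ 'd"
    assume "m \<noteq> n"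
    then show "measure lebesgue ((\<lambda>x. \<chi> i. if i = m then x$m + x$n else x$i) ` cbox u v)
        = \<bar>det (matrix (\<lambda>x::real^'d. \<chi> i. if i = m then x$m + x$n else x$i))\<bar> * measure lebesgue (cbox u v)"
      by (simp add: det_shear measure_shear_cbox)
  qed
  then show ?thesis by simp
qed

lemma lmeasurable_matrix_image:
  fixes A :: "real ^ 'd ^ 'd"
  assumes "S \<in> lmeasurable"
  shows "((*v) A) ` S \<in> lmeasurable" "measure lebesgue (((*v) A) ` S) = \<bar>det A\<bar> * measure lebesgue S"
  using measure_linear_image_from_cboxes[OF _ measure_linear_image_cbox assms, of "(*v) A"] by auto

text \<open>Exhausting \<open>S\<close> by its intersections with balls reduces to sets of finite
  measure.\<close>

lemma lebesgue_matrix_image: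
  fixes A :: "real ^ 'd ^ 'd"
  assumes "S \<in> sets lebesgue" and "invertible A"
  shows "((*v) A) ` S \<in> sets lebesgue" "emeasure lebesgue (((*v) A) ` S) = ennreal \<bar>det A\<bar> * emeasure lebesgue S"
proof -
  define B where "B n = S \<inter> cball 0 (real n)" for n
  have B: "B n \<in> lmeasurable" for n
    unfolding B_def using assms(1) by (intro bounded_set_imp_lmeasurable) (auto intro: bounded_subset[OF bounded_cball])
  have S: "S = (\<Union>n. B n)"
    by (auto simp: B_def real_arch_simple)
  have inc: "incseq B" "incseq (\<lambda>n. ((*v) A) ` B n)"
    unfolding incseq_def B_def by (fastforce)+
  have AS: "((*v) A) ` S = (\<Union>n. ((*v) A) ` B n)"
    by (subst S) auto
  have Bm: "range B \<subseteq> sets lebesgue" "range (\<lambda>n. ((*v) A) ` B n) \<subseteq> sets lebesgue"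
    using B lmeasurable_matrix_image(1)[OF B, of A] by (auto intro: fmeasurableD)
  show "((*v) A) ` S \<in> sets lebesgue"
    unfolding AS using Bm(2) by (metis sets.countable_UN)
  have "emeasure lebesgue (((*v) A) ` S) = (SUP n. emeasure lebesgue (((*v) A) ` B n))"
    unfolding AS using SUP_emeasure_incseq[OF Bm(2) inc(2)] by simp
  also have "\<dots> = (SUP n. ennreal \<bar>det A\<bar> * emeasure lebesgue (B n))"
    using B lmeasurable_matrix_image[OF B, of A]
    by (simp add: emeasure_eq_measure2 ennreal_mult)
  also have "\<dots> = ennreal \<bar>det A\<bar> * (SUP n. emeasure lebesgue (B n))"
    by (simp add: SUP_mult_left_ennreal)
  also have "(SUP n. emeasure lebesgue (B n)) = emeasure lebesgue S"
    unfolding S using SUP_emeasure_incseq[OF Bm(1) inc(1)] by simp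
  finally show "emeasure lebesgue (((*v) A) ` S) = ennreal \<bar>det A\<bar> * emeasure lebesgue S" .
qed

lemma matrix_inv_mult:
  fixes A :: "real ^ 'd ^ 'd"
  assumes "invertible A"
  shows "A ** matrix_inv A = mat 1" "matrix_inv A ** A = mat 1"
  using someI_ex[OF assms[unfolded invertible_def]] by (auto simp: matrix_inv_def)

lemma matrix_inv_cancel:
  fixes A :: "real ^ 'd ^ 'd"
  assumes "invertible A"
  shows "A *v (matrix_inv A *v x) = x" "matrix_inv A *v (A *v x) = x"
  using matrix_inv_mult[OF assms] by (simp_all add: matrix_vector_mul_assoc)

lemma abs_det_matrix_inv:
  fixes A :: "real ^ 'd ^ 'd"
  assumes "invertible A"
  shows "\<bar>det A\<bar> * \<bar>det (matrix_inv A)\<bar> = 1"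
  using matrix_inv_mult(1)[OF assms] by (metis abs_mult abs_one det_I det_mul)

text \<open>Preimages become images under the inverse matrix, to which the image formula
  applies.\<close>

lemma affine_vimage_eq:
  fixes A :: "real ^ 'd ^ 'd"
  assumes "invertible A"
  shows "(\<lambda>x. A *v x + v) -` S = ((*v) (matrix_inv A)) ` ((+) (- v) ` S)"
proof -
  have "x \<in> ((*v) (matrix_inv A)) ` ((+) (- v) ` S)" if "A *v x + v \<in> S" for x
    using that by (intro image_eqI[where x = "A *v x"] image_eqI[where x = "A *v x + v"])
      (auto simp: matrix_inv_cancel assms)
  then show ?thesis
    by (auto simp: matrix_inv_cancel assms)
qed

lemma lebesgue_affine_vimage:
  fixes A :: "real ^ 'd ^ 'd"
  assumes "invertible A" "S \<in> sets lebesgue"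
  shows "(\<lambda>x. A *v x + v) -` S \<in> sets lebesgue"
    "ennreal \<bar>det A\<bar> * emeasure lebesgue ((\<lambda>x. A *v x + v) -` S) = emeasure lebesgue S"
proof -
  have i: "invertible (matrix_inv A)"
    using matrix_inv_mult[OF assms(1)] by (auto simp: invertible_def)
  have t: "(+) (- v) ` S \<in> sets lebesgue" "emeasure lebesgue ((+) (- v) ` S) = emeasure lebesgue S"
    using emeasure_lebesgue_affine[of 1 "-v" S] lebesgue_sets_translation[OF assms(2), of "-v"] by simp_all
  show "(\<lambda>x. A *v x + v) -` S \<in> sets lebesgue"
    unfolding affine_vimage_eq[OF assms(1)] using lebesgue_matrix_image(1)[OF t(1) i] .
  show "ennreal \<bar>det A\<bar> * emeasure lebesgue ((\<lambda>x. A *v x + v) -` S) = emeasure lebesgue S"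
    unfolding affine_vimage_eq[OF assms(1)] lebesgue_matrix_image(2)[OF t(1) i] t(2)
    by (simp add: mult.assoc[symmetric] ennreal_mult'[symmetric] abs_det_matrix_inv[OF assms(1)])
qed

lemma measurable_lebesgue_matrix_affine:
  fixes A :: "real ^ 'd ^ 'd"
  assumes "invertible A"
  shows "(\<lambda>x. A *v x + v) \<in> lebesgue \<rightarrow>\<^sub>M lebesgue"
  using lebesgue_affine_vimage(1)[OF assms] by (auto simp: measurable_def)

text \<open>As an identity of measures, the change of variables serves extended integrals, Bochner
  integrals and almost-everywhere statements by one and the same substitution.\<close>

proposition lebesgue_matrix_affine:
  fixes A :: "real ^ 'd ^ 'd"
  assumes "invertible A"
  shows "lebesgue = density (distr lebesgue lebesgue (\<lambda>x. A *v x + v)) (\<lambda>_. ennreal \<bar>det A\<bar>)"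
proof (rule measure_eqI)
  fix S :: "(real ^ 'd) set" assume S: "S \<in> sets lebesgue"
  then show "emeasure lebesgue S =
      emeasure (density (distr lebesgue lebesgue (\<lambda>x. A *v x + v)) (\<lambda>_. ennreal \<bar>det A\<bar>)) S"
    using lebesgue_affine_vimage(2)[OF assms S, of v] measurable_lebesgue_matrix_affine[OF assms, of v]
    by (simp add: emeasure_density nn_integral_cmult nn_integral_cmult_indicator emeasure_distr)
qed simp

lemma nn_integral_matrix_affine:
  fixes A :: "real ^ 'd ^ 'd"
  assumes A: "invertible A" and g: "g \<in> borel_measurable lebesgue"
  shows "(\<integral>\<^sup>+x. g x \<partial>lebesgue) = ennreal \<bar>det A\<bar> * (\<integral>\<^sup>+x. g (A *v x + v) \<partial>lebesgue)"
  using measurable_lebesgue_matrix_affine[OF A, of v] g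
  by (subst lebesgue_matrix_affine[OF A, of v])
    (simp add: nn_integral_density nn_integral_distr nn_integral_cmult)

lemma AE_matrix_affine:
  fixes A :: "real ^ 'd ^ 'd"
  assumes A: "invertible A" and "AE x in lebesgue. P x"
  shows "AE x in lebesgue. P (A *v x + v)"
proof -
  have "det A \<noteq> 0"
    using A by (simp add: invertible_det_nz)
  then have "AE x in distr lebesgue lebesgue (\<lambda>x. A *v x + v). P x"
    using assms(2) by (subst (asm) lebesgue_matrix_affine[OF A, of v]) (simp add: AE_density)
  then show ?thesis
    by (rule AE_distrD[OF measurable_lebesgue_matrix_affine[OF A]])
qed

lemma borel_measurable_matrix_affine:
  fixes A :: "real ^ 'd ^ 'd"
  assumes "invertible A" "g \<in> borel_measurable lebesgue"
  shows "(\<lambda>x. g (A *v x + v)) \<in> borel_measurable lebesgue"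
  using measurable_compose[OF measurable_lebesgue_matrix_affine[OF assms(1)] assms(2)] .

subsection \<open>Upper bounds for \<open>L\<^sup>p\<close> norms\<close>

text \<open>\<open>powr_convex\<close> settles positive arguments. If one argument is zero, the
  claim reduces to (s z)^p \<le> s z^p for 0 < s < 1, which holds because p \<ge> 1.\<close>

lemma convex_on_powr_nonneg:
  assumes "1 \<le> (p::real)"
  shows "convex_on {0..} (\<lambda>x. x powr p)"
proof (rule convex_onI)
  fix t x y :: real
  assume t: "0 < t" "t < 1" and xy: "x \<in> {0..}" "y \<in> {0..}"
  have le: "(s * z) powr p \<le> s * z powr p" if "0 < s" "s < 1" "0 \<le> z" for s z :: real
    using that assms by (simp add: powr_mult mult_right_mono powr_le_one_le)
  consider "x = 0" | "y = 0" | "x > 0" "y > 0"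
    using xy by fastforce
  then show "((1 - t) *\<^sub>R x + t *\<^sub>R y) powr p \<le> (1 - t) * x powr p + t * y powr p"
  proof cases
    case 3
    then show ?thesis
      using convex_onD[OF powr_convex[OF assms], of t x y] t by simp
  qed (use le[of t y] le[of "1 - t" x] t xy in auto)
qed simp

text \<open>An upper bound for the norm in place of the norm: through the extended integral, a bound
  and membership in L^p travel together. The values may lie in any normed space because real-valued
  majorants are estimated as well.\<close>

definition Lp_le :: "real \<Rightarrow> (real ^ 'd \<Rightarrow> 'b::real_normed_vector) \<Rightarrow> real \<Rightarrow> bool" where
  "Lp_le p g r \<longleftrightarrow> g \<in> borel_measurable lebesgue \<and> 0 \<le> r \<and>
     (\<integral>\<^sup>+x. ennreal (norm (g x) powr p) \<partial>lebesgue) \<le> ennreal (r powr p)"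

lemma powr_inverse_le_iff:
  assumes "1 \<le> (p::real)" "0 \<le> y"
  shows "y powr (1/p) \<le> r \<longleftrightarrow> 0 \<le> r \<and> y \<le> r powr p"
proof
  assume le: "y powr (1/p) \<le> r"
  have "0 \<le> y powr (1/p)" by simp
  with le have "0 \<le> r" by (rule order_trans[rotated])
  moreover have "(y powr (1/p)) powr p \<le> r powr p"
    using assms by (intro powr_mono2 le) auto
  ultimately show "0 \<le> r \<and> y \<le> r powr p"
    using assms by (simp add: powr_powr)
next
  assume "0 \<le> r \<and> y \<le> r powr p"
  then have "y powr (1/p) \<le> (r powr p) powr (1/p)"
    using assms by (intro powr_mono2) auto
  then show "y powr (1/p) \<le> r"
    using assms \<open>0 \<le> r \<and> _\<close> by (simp add: powr_powr)
qed

text \<open>If the p-th power is not integrable, its extended integral is infinite and exceeds every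
  real bound.\<close>

lemma Lp_le_iff:
  assumes "1 \<le> p"
  shows "Lp_le p g r \<longleftrightarrow> g \<in> Lp p UNIV \<and> Lp_norm p UNIV g \<le> r"
proof (cases "g \<in> borel_measurable lebesgue")
  case meas: True
  then have [measurable]: "(\<lambda>x. norm (g x) powr p) \<in> borel_measurable lebesgue"
    by measurable
  show ?thesis
  proof (cases "integrable lebesgue (\<lambda>x. norm (g x) powr p)")
    case True
    have int: "(\<integral>\<^sup>+x. ennreal (norm (g x) powr p) \<partial>lebesgue) = ennreal (LINT x|lebesgue. norm (g x) powr p)"
      using True by (rule nn_integral_eq_integral) simp
    have nn: "(LINT x|lebesgue. norm (g x) powr p) \<ge> 0"
      by (rule integral_nonneg_AE) simp
    have "Lp_norm p UNIV g \<le> r \<longleftrightarrow> 0 \<le> r \<and> (LINT x|lebesgue. norm (g x) powr p) \<le> r powr p"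
    proof -
      have "Lp_norm p UNIV g = (LINT x|lebesgue. norm (g x) powr p) powr (1/p)"
        by (simp add: Lp_norm_def set_lebesgue_integral_def)
      then show ?thesis
        by (simp only: powr_inverse_le_iff[OF assms nn])
    qed
    moreover have "g \<in> Lp p UNIV"
      using True meas by (simp add: Lp_def)
    ultimately show ?thesis
      unfolding Lp_le_def int ennreal_le_iff[OF powr_ge_zero] using meas by blast
  next
    case False
    have "(\<integral>\<^sup>+x. ennreal (norm (g x) powr p) \<partial>lebesgue) = \<infinity>"
    proof (rule ccontr)
      assume "(\<integral>\<^sup>+x. ennreal (norm (g x) powr p) \<partial>lebesgue) \<noteq> \<infinity>"
      then have "integrable lebesgue (\<lambda>x. norm (g x) powr p)"
        by (intro integrableI_nonneg) (simp_all add: less_top[symmetric])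
      with False show False ..
    qed
    then show ?thesis
      using False by (simp add: Lp_le_def Lp_def top_unique)
  qed
qed (simp add: Lp_le_def Lp_def)

lemma Lp_le_measurable: "Lp_le p g r \<Longrightarrow> g \<in> borel_measurable lebesgue"
  by (simp add: Lp_le_def)

lemma Lp_le_mono:
  assumes "Lp_le p g r" "r \<le> s" "0 \<le> p"
  shows "Lp_le p g s"
proof -
  have "ennreal (r powr p) \<le> ennreal (s powr p)"
    using assms by (intro ennreal_leI powr_mono2) (auto simp: Lp_le_def)
  with assms show ?thesis
    unfolding Lp_le_def by (auto intro: order_trans)
qed

lemma Lp_le_dominated:
  assumes "Lp_le p g r" "h \<in> borel_measurable lebesgue" "AE x in lebesgue. norm (h x) \<le> norm (g x)" "0 \<le> p"
  shows "Lp_le p h r"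
proof -
  have "(\<integral>\<^sup>+x. ennreal (norm (h x) powr p) \<partial>lebesgue) \<le> (\<integral>\<^sup>+x. ennreal (norm (g x) powr p) \<partial>lebesgue)"
    using assms(3) by (intro nn_integral_mono_AE) (auto intro!: ennreal_leI powr_mono2 assms(4))
  then show ?thesis
    using assms by (auto simp: Lp_le_def)
qed

lemma Lp_le_zero_iff:
  assumes "0 < p"
  shows "Lp_le p g 0 \<longleftrightarrow> g \<in> borel_measurable lebesgue \<and> (AE x in lebesgue. g x = 0)"
proof (cases "g \<in> borel_measurable lebesgue")
  case True
  then have "(\<lambda>x. ennreal (norm (g x) powr p)) \<in> borel_measurable lebesgue"
    by measurable
  then show ?thesis
    using nn_integral_0_iff_AE[of "\<lambda>x. ennreal (norm (g x) powr p)" lebesgue] True by (simp add: Lp_le_def)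
qed (simp add: Lp_le_def)

lemma Lp_le_cmult:
  fixes c :: "'b::real_normed_field"
  assumes "Lp_le p g r" and "norm c \<le> K"
  assumes "0 \<le> p"
  shows "Lp_le p (\<lambda>x. c * g x) (K * r)"
proof -
  have [measurable]: "g \<in> borel_measurable lebesgue" using assms by (simp add: Lp_le_def)
  have K: "K \<ge> 0" using assms(2) norm_ge_zero order_trans by blast
  have "(\<lambda>x. c * g x) \<in> borel_measurable lebesgue"
    using borel_measurable_continuous_onI[of "\<lambda>y. c * y"] continuous_on_mult_left by measurable
  moreover have "(\<integral>\<^sup>+x. ennreal (norm (c * g x) powr p) \<partial>lebesgue) =
      ennreal (norm c powr p) * (\<integral>\<^sup>+x. ennreal (norm (g x) powr p) \<partial>lebesgue)"
    by (subst nn_integral_cmult[symmetric]) (auto simp: norm_mult powr_mult ennreal_mult)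
  moreover have "\<dots> \<le> ennreal (K powr p) * ennreal (r powr p)"
    using assms by (intro mult_mono ennreal_leI powr_mono2) (auto simp: Lp_le_def)
  ultimately show ?thesis
    using assms K by (simp add: Lp_le_def powr_mult ennreal_mult)
qed

text \<open>Minkowski's inequality, obtained from convexity of the p-th power. When one bound is
  zero that function vanishes almost everywhere, and this case is split off because the weights
  below divide by the bounds.\<close>

lemma Lp_le_add:
  fixes g h :: "real ^ 'd \<Rightarrow> 'b::{real_normed_vector, second_countable_topology}"
  assumes "1 \<le> p" and g: "Lp_le p g r" and h: "Lp_le p h s"
  shows "Lp_le p (\<lambda>x. g x + h x) (r + s)"
proof -
  have [measurable]: "g \<in> borel_measurable lebesgue" "h \<in> borel_measurable lebesgue"
    using g h by (simp_all add: Lp_le_def)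
  have rs: "0 \<le> r" "0 \<le> s" using g h by (auto simp: Lp_le_def)
  consider "r = 0" | "s = 0" | "r > 0" "s > 0"
    using rs by fastforce
  then show ?thesis
  proof cases
    case 1
    then have "AE x in lebesgue. norm (g x + h x) \<le> norm (h x)"
      using g assms(1) by (auto simp: Lp_le_zero_iff)
    then show ?thesis
      using 1 assms(1) by (auto intro!: Lp_le_dominated[OF h])
  next
    case 2
    then have "AE x in lebesgue. norm (g x + h x) \<le> norm (g x)"
      using h assms(1) by (auto simp: Lp_le_zero_iff)
    then show ?thesis
      using 2 assms(1) by (auto intro!: Lp_le_dominated[OF g])
  next
    case 3
    \<comment> \<open>The weights are r/(r+s) and s/(r+s): rescaling \<open>g\<close> by (r+s)/r and
      \<open>h\<close> by (r+s)/s gives both the bound r+s, and the sum is their convex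
      combination.\<close>
    define t where "t = s / (r + s)"
    define C D where "C = (1 - t) * ((r + s) / r) powr p" and "D = t * ((r + s) / s) powr p"
    have t: "0 \<le> t" "t \<le> 1" and CD: "0 \<le> C" "0 \<le> D"
      using 3 by (auto simp: t_def C_def D_def)
    have 1: "(1 - t) * ((r + s) / r * u) = u" "t * ((r + s) / s * u) = u" for u
    proof -
      have "r + s \<noteq> 0" "1 - t = r / (r + s)"
        using 3 by (auto simp: t_def field_simps)
      then show "(1 - t) * ((r + s) / r * u) = u" "t * ((r + s) / s * u) = u"
        using 3 by (simp_all add: t_def)
    qed
    have pt: "norm (g x + h x) powr p \<le> C * norm (g x) powr p + D * norm (h x) powr p" for x
    proof -
      have "norm (g x + h x) powr p \<le> (norm (g x) + norm (h x)) powr p"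
        using assms(1) by (intro powr_mono2 norm_triangle_ineq) auto
      also have "\<dots> \<le> (1 - t) * ((r + s) / r * norm (g x)) powr p + t * ((r + s) / s * norm (h x)) powr p"
        using convex_onD[OF convex_on_powr_nonneg[OF assms(1)] t, of "(r + s) / r * norm (g x)" "(r + s) / s * norm (h x)"] 3
        unfolding real_scaleR_def 1 by simp
      finally show ?thesis
        unfolding C_def D_def powr_mult by (simp add: mult.assoc)
    qed
    have "(\<integral>\<^sup>+x. ennreal (norm (g x + h x) powr p) \<partial>lebesgue)
        \<le> (\<integral>\<^sup>+x. ennreal C * ennreal (norm (g x) powr p) + ennreal D * ennreal (norm (h x) powr p) \<partial>lebesgue)"
      using pt CD by (intro nn_integral_mono) (simp flip: ennreal_plus ennreal_mult')
    also have "\<dots> = ennreal C * (\<integral>\<^sup>+x. ennreal (norm (g x) powr p) \<partial>lebesgue)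
        + ennreal D * (\<integral>\<^sup>+x. ennreal (norm (h x) powr p) \<partial>lebesgue)"
      by (simp add: nn_integral_add nn_integral_cmult)
    also have "\<dots> \<le> ennreal C * ennreal (r powr p) + ennreal D * ennreal (s powr p)"
      using g h by (intro add_mono mult_left_mono) (auto simp: Lp_le_def)
    also have "\<dots> = ennreal (C * r powr p + D * s powr p)"
      using CD by (simp flip: ennreal_plus ennreal_mult')
    also have "C * r powr p + D * s powr p = (r + s) powr p"
    proof -
      have "C * r powr p = (1 - t) * (r + s) powr p" "D * s powr p = t * (r + s) powr p"
        using 3 by (simp_all add: C_def D_def powr_divide)
      then show ?thesis
        by (simp add: left_diff_distrib)
    qed
    finally show ?thesis
      using rs by (simp add: Lp_le_def)
  qed
qed

lemma Lp_le_zero: "0 < p \<Longrightarrow> Lp_le p (\<lambda>x. 0) 0"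
  by (simp add: Lp_le_zero_iff)

lemma Lp_le_uminus: "Lp_le p g r \<Longrightarrow> Lp_le p (\<lambda>x. - g x) r"
  for g :: "real ^ 'd \<Rightarrow> 'b::{real_normed_vector, second_countable_topology}"
  by (simp add: Lp_le_def)

lemma Lp_le_diff:
  fixes g h :: "real ^ 'd \<Rightarrow> 'b::{real_normed_vector, second_countable_topology}"
  assumes "1 \<le> p" "Lp_le p g r" "Lp_le p h s"
  shows "Lp_le p (\<lambda>x. g x - h x) (r + s)"
  using Lp_le_add[OF assms(1,2) Lp_le_uminus[OF assms(3)]] by simp

lemma Lp_le_sum:
  fixes g :: "'i \<Rightarrow> real ^ 'd \<Rightarrow> 'b::{real_normed_vector, second_countable_topology}"
  assumes "1 \<le> p" "\<And>i. i \<in> I \<Longrightarrow> Lp_le p (g i) (r i)"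
  shows "Lp_le p (\<lambda>x. \<Sum>i\<in>I. g i x) (\<Sum>i\<in>I. r i)"
  using assms(2)
proof (induction I rule: infinite_finite_induct)
  case (insert i I)
  then show ?case
    using Lp_le_add[OF assms(1), of "g i" "r i" "\<lambda>x. \<Sum>i\<in>I. g i x" "\<Sum>i\<in>I. r i"] by simp
qed (use assms(1) in \<open>simp_all add: Lp_le_zero\<close>)

lemma Lp_le_indicator:
  fixes S :: "(real ^ 'd) set"
  assumes "1 \<le> p" "S \<in> lmeasurable"
  shows "Lp_le p (indicat_real S) (measure lebesgue S powr (1/p))"
proof -
  have "(\<integral>\<^sup>+x. ennreal (norm (indicat_real S x) powr p) \<partial>lebesgue) = (\<integral>\<^sup>+x. indicator S x \<partial>lebesgue)"
    by (intro nn_integral_cong) (auto simp: indicator_def)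
  also have "\<dots> = ennreal (measure lebesgue S)"
    using assms(2) by (subst nn_integral_indicator) (auto simp: emeasure_eq_measure2)
  finally show ?thesis
    using assms by (auto simp: Lp_le_def powr_powr)
qed

lemma Lp_normD:
  assumes "1 \<le> p" "g \<in> Lp p UNIV"
  shows "Lp_le p g (Lp_norm p UNIV g)"
  using assms by (simp add: Lp_le_iff)

lemma Lp_norm_nonneg: "0 \<le> Lp_norm p \<Omega> g"
  by (simp add: Lp_norm_def)

lemma Lp_norm_restrict:
  assumes "f \<in> Lp p \<Omega>" "\<Omega> \<in> sets lebesgue"
  shows "f \<in> Lp p UNIV" "Lp_norm p \<Omega> f = Lp_norm p UNIV f"
proof -
  show "f \<in> Lp p UNIV"
    using assms by (simp add: Lp_def)
  have [measurable]: "f \<in> borel_measurable lebesgue" using assms by (simp add: Lp_def)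
  have "(LINT x|lebesgue. indicator \<Omega> x *\<^sub>R norm (f x) powr p) = (LINT x|lebesgue. norm (f x) powr p)"
    using assms by (intro integral_cong_AE) (auto simp: Lp_def indicator_def)
  then show "Lp_norm p \<Omega> f = Lp_norm p UNIV f"
    by (simp add: Lp_norm_def set_lebesgue_integral_def)
qed

section \<open>Density of continuous functions with compact support in an open set\<close>

lemma eventually_Lp_le:
  fixes u :: "nat \<Rightarrow> real ^ 'd \<Rightarrow> 'b::{real_normed_vector, second_countable_topology}"
  assumes "1 \<le> p" and u: "\<And>n. u n \<in> borel_measurable lebesgue" and w: "Lp_le p w r"
    and bound: "\<And>n. AE x in lebesgue. norm (u n x) \<le> norm (w x)"
    and lim: "AE x in lebesgue. (\<lambda>n. u n x) \<longlonglongrightarrow> 0" and "0 < e"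
  shows "\<forall>\<^sub>F n in sequentially. Lp_le p (u n) e"
proof -
  have [measurable]: "w \<in> borel_measurable lebesgue" "\<And>n. u n \<in> borel_measurable lebesgue"
    using w u by (simp_all add: Lp_le_def)
  have "(\<lambda>n. \<integral>\<^sup>+x. ennreal (norm (u n x) powr p) \<partial>lebesgue) \<longlonglongrightarrow> (\<integral>\<^sup>+(x::real^'d). 0 \<partial>lebesgue)"
  proof (rule nn_integral_dominated_convergence[where w = "\<lambda>x. ennreal (norm (w x) powr p)" and u' = "\<lambda>_. 0"])
    show "AE x in lebesgue. ennreal (norm (u n x) powr p) \<le> ennreal (norm (w x) powr p)" for n
      using bound[of n] by eventually_elim (use assms(1) in \<open>auto intro!: ennreal_leI powr_mono2\<close>)
    show "(\<integral>\<^sup>+x. ennreal (norm (w x) powr p) \<partial>lebesgue) < \<infinity>"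
      using w by (auto simp: Lp_le_def intro: le_less_trans)
    show "AE x in lebesgue. (\<lambda>n. ennreal (norm (u n x) powr p)) \<longlonglongrightarrow> 0"
      using lim
    proof eventually_elim
      case (elim x)
      have "(\<lambda>n. norm (u n x) powr p) \<longlonglongrightarrow> 0 powr p"
        using assms(1) by (intro tendsto_powr' tendsto_norm_zero elim tendsto_const) auto
      then show ?case
        using tendsto_ennrealI by fastforce
    qed
  qed measurable
  moreover have "(0::ennreal) < ennreal (e powr p)"
    using \<open>0 < e\<close> by simp
  ultimately have "\<forall>\<^sub>F n in sequentially. (\<integral>\<^sup>+x. ennreal (norm (u n x) powr p) \<partial>lebesgue) < ennreal (e powr p)"
    by (intro order_tendstoD(2)) auto
  then show ?thesis
    by eventually_elim (use \<open>0 < e\<close> in \<open>auto simp: Lp_le_def\<close>)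
qed

text \<open>The radial retraction onto the disc of radius \<open>m\<close>; unlike cutting off to
  zero it is continuous.\<close>

definition trunc :: "real \<Rightarrow> complex \<Rightarrow> complex" where
  "trunc m z = of_real (m / max m (norm z)) * z"

lemma trunc_props:
  assumes "0 < m"
  shows "norm (trunc m z) \<le> m" "norm (trunc m z) \<le> norm z" "norm z \<le> m \<Longrightarrow> trunc m z = z"
    "continuous_on UNIV (trunc m)"
proof -
  have n: "norm (trunc m z) = m * norm z / max m (norm z)"
    using assms by (simp add: trunc_def norm_mult norm_divide)
  show "norm (trunc m z) \<le> m" "norm (trunc m z) \<le> norm z"
    unfolding n using assms by (auto simp: field_simps max_def mult_mono)
  show "norm z \<le> m \<Longrightarrow> trunc m z = z"
    using assms by (simp add: trunc_def max_def)
  show "continuous_on UNIV (trunc m)"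
    unfolding trunc_def using assms by (intro continuous_intros) auto
qed

text \<open>Two passages to the limit. Cutting off in space and truncating in value moves
  \<open>f\<close> by little and leaves a bounded function with compact support; then
  \<open>f\<close> is replaced inside the truncation by continuous functions. Both use dominated
  convergence.\<close>

proposition Lp_approx_continuous_compact_support:
  fixes f :: "real ^ 'd \<Rightarrow> complex"
  assumes "1 \<le> p" "open \<Omega>" and f: "f \<in> Lp p \<Omega>" and "0 < e"
  obtains g K where "continuous_on UNIV g" "compact K" "K \<subseteq> \<Omega>" "\<And>x. x \<notin> K \<Longrightarrow> g x = 0"
    "Lp_le p (\<lambda>x. f x - g x) e"
proof -
  obtain C :: "nat \<Rightarrow> (real ^ 'd) set" where C: "\<And>n. compact (C n)" "\<And>n. C n \<subseteq> \<Omega>"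
    "\<And>n. C n \<subseteq> interior (C (Suc n))" "\<Union>(range C) = \<Omega>"
    using open_Union_compact_subsets[OF \<open>open \<Omega>\<close>] by metis
  have [measurable]: "f \<in> borel_measurable lebesgue" and f0: "AE x in lebesgue. x \<notin> \<Omega> \<longrightarrow> f x = 0"
    using f by (simp_all add: Lp_def)
  have Lf: "Lp_le p f (Lp_norm p UNIV f)"
    using f by (intro Lp_normD assms) (simp add: Lp_def)
  \<comment> \<open>A Urysohn function separating \<open>C n\<close> from the complement of the
    interior of \<open>C (Suc n)\<close>; taking the interior makes that second set closed.\<close>
  have "\<exists>cut::real ^ 'd \<Rightarrow> real. continuous_on UNIV cut \<and> (\<forall>x. 0 \<le> cut x \<and> cut x \<le> 1) \<and> (\<forall>x\<in>C n. cut x = 1)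
      \<and> (\<forall>x. x \<notin> C (Suc n) \<longrightarrow> cut x = 0)" for n
  proof -
    have "closed (C n)" "closed (- interior (C (Suc n)))" "C n \<inter> - interior (C (Suc n)) = {}"
      using C(1)[of n] C(3)[of n] by (auto intro: compact_imp_closed)
    then obtain cut :: "real ^ 'd \<Rightarrow> real" where cut: "continuous_on UNIV cut" "\<And>x. cut x \<in> closed_segment 1 0"
      "\<And>x. x \<in> C n \<Longrightarrow> cut x = 1" "\<And>x. x \<in> - interior (C (Suc n)) \<Longrightarrow> cut x = 0"
      using Urysohn[of "C n" "- interior (C (Suc n))" 1 0] by metis
    show ?thesis
      using cut interior_subset[of "C (Suc n)"] by (intro exI[of _ cut]) (auto simp: closed_segment_eq_real_ivl)
  qed
  then obtain cut :: "nat \<Rightarrow> real ^ 'd \<Rightarrow> real" where cut: "\<And>n. continuous_on UNIV (cut n)"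
    "\<And>n x. 0 \<le> cut n x" "\<And>n x. cut n x \<le> 1" "\<And>n x. x \<in> C n \<Longrightarrow> cut n x = 1" "\<And>n x. x \<notin> C (Suc n) \<Longrightarrow> cut n x = 0"
    by metis
  have Cmono: "C i \<subseteq> C j" if "i \<le> j" for i j
    using lift_Suc_mono_le[of C, OF _ that] C(3) interior_subset by (metis subset_trans)
  have [measurable]: "cut n \<in> borel_measurable lebesgue" for n
    using cut(1) continuous_imp_measurable_on_sets_lebesgue[of UNIV "cut n"] by simp
  have tm[measurable]: "(\<lambda>x. trunc (real (Suc m)) (q x)) \<in> borel_measurable lebesgue"
    if "q \<in> borel_measurable lebesgue" for m and q :: "real ^ 'd \<Rightarrow> complex"
    using measurable_compose[OF that borel_measurable_continuous_onI[OF trunc_props(4)[of "real (Suc m)"]]] by simp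
  have tb: "norm (trunc (real (Suc m)) z) \<le> Suc m" "norm (trunc (real (Suc m)) z) \<le> norm z" for m z
    using trunc_props[of "real (Suc m)"] by simp_all
  have cutb: "norm (of_real (cut m x) * z) \<le> norm z" for m x and z :: complex
    using cut(2,3)[of m x] by (simp add: norm_mult mult_left_le_one_le)
  have "\<forall>\<^sub>F m in sequentially. Lp_le p (\<lambda>x. of_real (cut m x) * trunc (Suc m) (f x) - f x) (e/2)"
  proof (rule eventually_Lp_le[OF \<open>1 \<le> p\<close> _ Lp_le_cmult[OF Lf order_refl, of 2]])
    show "AE x in lebesgue. norm (of_real (cut m x) * trunc (Suc m) (f x) - f x) \<le> norm (2 * f x)" for m
    proof (rule AE_I2)
      fix x
      have "norm (of_real (cut m x) * trunc (Suc m) (f x) - f x) \<le> norm (of_real (cut m x) * trunc (Suc m) (f x)) + norm (f x)"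
        by (rule norm_triangle_ineq4)
      also have "\<dots> \<le> norm (f x) + norm (f x)"
        using cutb tb(2) order_trans by (intro add_right_mono) blast
      finally show "norm (of_real (cut m x) * trunc (Suc m) (f x) - f x) \<le> norm (2 * f x)"
        by (simp add: norm_mult)
    qed
    show "AE x in lebesgue. (\<lambda>m. of_real (cut m x) * trunc (Suc m) (f x) - f x) \<longlonglongrightarrow> 0"
      using f0
    proof eventually_elim
      case (elim x)
      have "\<forall>\<^sub>F m in sequentially. of_real (cut m x) * trunc (Suc m) (f x) - f x = 0"
      proof (cases "x \<in> \<Omega>")
        case True
        then obtain n where n: "x \<in> C n" using C(4) by blast
        obtain k :: nat where k: "norm (f x) \<le> real k" using real_arch_simple by blast
        have "of_real (cut m x) * trunc (Suc m) (f x) - f x = 0" if "m \<ge> max n k" for m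
          using n Cmono[of n m] cut(4)[of x m] k that trunc_props(3)[of "real (Suc m)" "f x"] by auto
        then show ?thesis
          using eventually_sequentially by blast
      next
        case False
        then show ?thesis using elim by (simp add: trunc_def)
      qed
      then show ?case by (rule tendsto_eventually)
    qed
  qed (use \<open>0 < e\<close> \<open>1 \<le> p\<close> in \<open>measurable, auto\<close>)
  then obtain m where m: "Lp_le p (\<lambda>x. of_real (cut m x) * trunc (Suc m) (f x) - f x) (e/2)"
    using eventually_happens by fastforce
  \<comment> \<open>Measurability yields continuous \<open>h n\<close> converging to
    \<open>f\<close> off a null set, but without any bound. The truncation and the cut-off, already
    fixed by \<open>m\<close>, supply the majorant \<open>w\<close>.\<close>
  obtain N h where N: "negligible N" and h: "\<And>n. continuous_on UNIV (h n)"
    and hlim: "\<And>x. x \<notin> N \<Longrightarrow> (\<lambda>n. h n x) \<longlonglongrightarrow> f x"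
    using lebesgue_measurable_imp_measurable_on[of f UNIV] by (auto simp: measurable_on_def)
  have [measurable]: "h n \<in> borel_measurable lebesgue" for n
    using h continuous_imp_measurable_on_sets_lebesgue[of UNIV "h n"] by simp
  have Km: "C (Suc m) \<in> lmeasurable"
    using C(1) by (rule lmeasurable_compact)
  have w: "Lp_le p (\<lambda>x. 2 * real (Suc m) * indicator (C (Suc m)) x :: real) (2 * real (Suc m) * measure lebesgue (C (Suc m)) powr (1/p))"
    using \<open>1 \<le> p\<close> by (intro Lp_le_cmult Lp_le_indicator Km) auto
  have "\<forall>\<^sub>F n in sequentially. Lp_le p (\<lambda>x. of_real (cut m x) * trunc (Suc m) (h n x) - of_real (cut m x) * trunc (Suc m) (f x)) (e/2)"
  proof (rule eventually_Lp_le[OF \<open>1 \<le> p\<close> _ w])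
    show "AE x in lebesgue. norm (of_real (cut m x) * trunc (Suc m) (h n x) - of_real (cut m x) * trunc (Suc m) (f x))
        \<le> norm (2 * real (Suc m) * indicator (C (Suc m)) x :: real)" for n
    proof (rule AE_I2)
      fix x
      have "norm (of_real (cut m x) * (trunc (Suc m) (h n x) - trunc (Suc m) (f x))) \<le> norm (trunc (Suc m) (h n x) - trunc (Suc m) (f x))"
        by (rule cutb)
      also have "\<dots> \<le> norm (trunc (Suc m) (h n x)) + norm (trunc (Suc m) (f x))"
        by (rule norm_triangle_ineq4)
      also have "\<dots> \<le> real (Suc m) + real (Suc m)"
        by (intro add_mono tb)
      finally show "norm (of_real (cut m x) * trunc (Suc m) (h n x) - of_real (cut m x) * trunc (Suc m) (f x))
        \<le> norm (2 * real (Suc m) * indicator (C (Suc m)) x :: real)"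
        using cut(5)[of x m] by (cases "x \<in> C (Suc m)") (auto simp: right_diff_distrib)
    qed
    have "AE x in lebesgue. x \<notin> N"
      using N by (simp add: AE_not_in negligible_iff_null_sets)
    then show "AE x in lebesgue. (\<lambda>n. of_real (cut m x) * trunc (Suc m) (h n x) - of_real (cut m x) * trunc (Suc m) (f x)) \<longlonglongrightarrow> 0"
    proof eventually_elim
      case (elim x)
      have "isCont (trunc (Suc m)) (f x)"
        using trunc_props(4)[of "real (Suc m)"] by (simp add: continuous_on_eq_continuous_at)
      then have "(\<lambda>n. trunc (Suc m) (h n x)) \<longlonglongrightarrow> trunc (Suc m) (f x)"
        using hlim[OF elim] by (rule isCont_tendsto_compose)
      then show ?case
        by (intro LIM_zero tendsto_mult_left)
    qed
  qed (use \<open>0 < e\<close> in \<open>measurable, auto\<close>)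
  then obtain n where n: "Lp_le p (\<lambda>x. of_real (cut m x) * trunc (Suc m) (h n x) - of_real (cut m x) * trunc (Suc m) (f x)) (e/2)"
    using eventually_happens by fastforce
  show thesis
  proof (rule that[of "\<lambda>x. of_real (cut m x) * trunc (Suc m) (h n x)" "C (Suc m)"])
    show "continuous_on UNIV (\<lambda>x. of_real (cut m x) * trunc (Suc m) (h n x))"
      by (intro continuous_intros cut(1) continuous_on_compose2[OF trunc_props(4)] h) auto
    show "Lp_le p (\<lambda>x. f x - of_real (cut m x) * trunc (Suc m) (h n x)) e"
      using Lp_le_uminus[OF Lp_le_add[OF \<open>1 \<le> p\<close> m n]] by (simp add: algebra_simps)
  qed (use C cut(5) in auto)
qed

subsection \<open>Lattice cells and step functions\<close>

definition vfloor :: "real ^ 'd \<Rightarrow> int ^ 'd" where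
  "vfloor x = (\<chi> i. \<lfloor>x $ i\<rfloor>)"

definition vfrac :: "real ^ 'd \<Rightarrow> real ^ 'd" where
  "vfrac x = x - int_vec (vfloor x)"

definition unit_cell :: "(real ^ 'd) set" where
  "unit_cell = {y. \<forall>i. 0 \<le> y $ i \<and> y $ i < 1}"

lemma int_vec_diff: "int_vec (k - l) = int_vec k - int_vec l"
  by (simp add: int_vec_def vec_eq_iff)

lemma vfrac_in_unit_cell: "vfrac x \<in> unit_cell"
  by (simp add: unit_cell_def vfrac_def int_vec_def vfloor_def) linarith

lemma vfloor_plus_vfrac: "int_vec (vfloor x) + vfrac x = x"
  by (simp add: vfrac_def)

lemma vfloor_eq_iff: "vfloor x = k \<longleftrightarrow> x - int_vec k \<in> unit_cell"
  by (auto simp: unit_cell_def vfloor_def int_vec_def vec_eq_iff floor_eq_iff algebra_simps)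

text \<open>\<open>One\<close> abbreviates a sum over \<open>Basis\<close>, so its components appear
  in this expanded form.\<close>

lemma sum_Basis_nth: "(\<Sum>x\<in>(Basis :: (real ^ 'd) set). x $ i) = 1"
proof -
  have "(\<Sum>x\<in>(Basis :: (real ^ 'd) set). x $ i) = One $ i"
    by simp
  also have "\<dots> = (One :: real ^ 'd) \<bullet> axis i 1"
    by (rule cart_eq_inner_axis)
  also have "\<dots> = 1"
    by (rule inner_sum_Basis) (simp add: axis_in_Basis_iff)
  finally show ?thesis .
qed

lemma unit_cell_bounds: "box 0 One \<subseteq> (unit_cell :: (real ^ 'd) set)" "(unit_cell :: (real ^ 'd) set) \<subseteq> cbox 0 One"
  by (auto simp: unit_cell_def mem_box_cart less_imp_le sum_Basis_nth)

lemma unit_cell_borel: "(unit_cell :: (real ^ 'd) set) \<in> sets borel"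
proof -
  have eq: "unit_cell = {y::real^'d. \<forall>i. 0 \<le> y $ i} \<inter> (\<Inter>i. {y. y $ i < 1})"
    by (auto simp: unit_cell_def)
  have "closed {y::real^'d. \<forall>i. 0 \<le> y $ i}"
    by (intro closed_Collect_all closed_Collect_le continuous_intros)
  then have c: "{y::real^'d. \<forall>i. 0 \<le> y $ i} \<in> sets borel"
    by (rule borel_closed)
  have "open (\<Inter>i. {y::real^'d. y $ i < 1})"
    by (intro open_INT ballI open_Collect_less continuous_intros) simp
  then have o: "(\<Inter>i. {y::real^'d. y $ i < 1}) \<in> sets borel"
    by (rule borel_open)
  show ?thesis
    unfolding eq using c o by (rule sets.Int)
qed

lemma unit_cell_lebesgue [measurable]: "unit_cell \<in> sets lebesgue"
  using unit_cell_borel by auto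

text \<open>The half-open cell lies between the open and the closed unit box, both of measure
  one.\<close>

lemma emeasure_unit_cell: "emeasure lebesgue (unit_cell :: (real ^ 'd) set) = 1"
proof -
  have "emeasure lborel (box 0 One :: (real ^ 'd) set) = 1" "emeasure lborel (cbox 0 One :: (real ^ 'd) set) = 1"
    by (simp_all add: emeasure_lborel_box_eq emeasure_lborel_cbox_eq)
  moreover have "emeasure lborel (box 0 One :: (real ^ 'd) set) \<le> emeasure lborel (unit_cell :: (real ^ 'd) set)"
    using unit_cell_bounds(1) unit_cell_borel by (intro emeasure_mono) auto
  moreover have "emeasure lborel (unit_cell :: (real ^ 'd) set) \<le> emeasure lborel (cbox 0 One :: (real ^ 'd) set)"
    using unit_cell_bounds(2) by (intro emeasure_mono) auto
  ultimately have "emeasure lborel (unit_cell :: (real ^ 'd) set) = 1"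
    by (simp add: antisym)
  moreover have "main_part lborel (unit_cell :: (real ^ 'd) set) = unit_cell"
    by (rule main_part) (simp add: unit_cell_borel)
  ultimately show ?thesis
    by (simp add: emeasure_completion del: main_part)
qed

lemma invertible_mat_1: "invertible (mat 1 :: real ^ 'd ^ 'd)"
  unfolding invertible_def by (intro exI[of _ "mat 1"]) simp

lemma nn_integral_lebesgue_shift:
  fixes g :: "real ^ 'd \<Rightarrow> ennreal"
  assumes "g \<in> borel_measurable lebesgue"
  shows "(\<integral>\<^sup>+x. g (x + v) \<partial>lebesgue) = (\<integral>\<^sup>+x. g x \<partial>lebesgue)"
  using nn_integral_matrix_affine[OF invertible_mat_1 assms, of v] by simp

lemma borel_measurable_lebesgue_shift:
  fixes g :: "real ^ 'd \<Rightarrow> 'b::topological_space"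
  assumes "g \<in> borel_measurable lebesgue"
  shows "(\<lambda>x. g (x + v)) \<in> borel_measurable lebesgue"
  using borel_measurable_matrix_affine[OF invertible_mat_1 assms, of v] by simp

text \<open>The target is countable, so it is enough that the fibres are measurable, and these are
  translates of the unit cell.\<close>

lemma measurable_vfloor [measurable]: "vfloor \<in> measurable lebesgue (count_space UNIV)"
proof -
  have eq: "indicat_real (vfloor -` {k}) = (\<lambda>x. indicator unit_cell (x + - int_vec k))" for k :: "int ^ 'd"
    by (auto simp: indicator_def vfloor_eq_iff fun_eq_iff)
  have "indicat_real (vfloor -` {k :: int ^ 'd}) \<in> borel_measurable lebesgue" for k
    unfolding eq by (intro borel_measurable_lebesgue_shift borel_measurable_indicator unit_cell_lebesgue)
  then show ?thesis
    by (auto simp: measurable_count_space_eq2_countable borel_measurable_indicator_iff)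
qed

text \<open>Every point lies in exactly one lattice cell: insert the sum of the cell indicators,
  exchange it with the integral, and translate each cell to the origin.\<close>

proposition nn_integral_tile:
  fixes H :: "real ^ 'd \<Rightarrow> ennreal"
  assumes H: "H \<in> borel_measurable lebesgue"
  shows "(\<integral>\<^sup>+x. H x \<partial>lebesgue) = (\<integral>\<^sup>+k. (\<integral>\<^sup>+y. H (y + int_vec k) * indicator unit_cell y \<partial>lebesgue) \<partial>count_space UNIV)"
proof -
  note [measurable] = H
  have "H x = (\<integral>\<^sup>+k. H x * indicator {vfloor x} k \<partial>count_space UNIV)" for x
    by (simp add: nn_integral_cmult_indicator)
  then have "(\<integral>\<^sup>+x. H x \<partial>lebesgue) = (\<integral>\<^sup>+x. (\<integral>\<^sup>+k. H x * indicator {k} (vfloor x) \<partial>count_space UNIV) \<partial>lebesgue)"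
    by (simp add: indicator_def eq_commute)
  also have "\<dots> = (\<integral>\<^sup>+k. (\<integral>\<^sup>+x. H x * indicator {k} (vfloor x) \<partial>lebesgue) \<partial>count_space UNIV)"
    by (rule nn_integral_count_space_nn_integral) auto
  also have "\<dots> = (\<integral>\<^sup>+k. (\<integral>\<^sup>+y. H (y + int_vec k) * indicator unit_cell y \<partial>lebesgue) \<partial>count_space UNIV)"
  proof (rule nn_integral_cong)
    fix k :: "int ^ 'd"
    have "(\<integral>\<^sup>+x. H x * indicator {k} (vfloor x) \<partial>lebesgue)
        = (\<integral>\<^sup>+x. H (x + int_vec k) * indicator {k} (vfloor (x + int_vec k)) \<partial>lebesgue)"
      by (rule nn_integral_lebesgue_shift[symmetric]) measurable
    then show "(\<integral>\<^sup>+x. H x * indicator {k} (vfloor x) \<partial>lebesgue) = (\<integral>\<^sup>+y. H (y + int_vec k) * indicator unit_cell y \<partial>lebesgue)"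
      by (simp add: indicator_def vfloor_eq_iff)
  qed
  finally show ?thesis .
qed

lemma borel_measurable_vfrac:
  fixes g :: "real ^ 'd \<Rightarrow> 'b::topological_space"
  assumes "g \<in> borel_measurable lebesgue"
  shows "(\<lambda>x. g (vfrac x)) \<in> borel_measurable lebesgue"
proof -
  have "(\<lambda>x. g (x + - int_vec k)) \<in> borel_measurable lebesgue" for k
    by (rule borel_measurable_lebesgue_shift[OF assms])
  from measurable_compose_countable[OF this measurable_vfloor] show ?thesis
    by (simp add: vfrac_def)
qed

text \<open>After substituting u = M x, the first factor is constant on each cell and the second
  takes the same values on every cell, so the tiled integral splits into a product. The determinant
  stays on the left, which avoids dividing extended reals.\<close>

lemma nn_integral_step_times_periodic:
  fixes M :: "real ^ 'd ^ 'd" and G :: "real ^ 'd \<Rightarrow> ennreal" and s :: "int ^ 'd \<Rightarrow> ennreal"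
  assumes M: "invertible M" and G[measurable]: "G \<in> borel_measurable lebesgue"
  shows "ennreal \<bar>det M\<bar> * (\<integral>\<^sup>+x. s (vfloor (M *v x)) * G (vfrac (M *v x)) \<partial>lebesgue)
    = (\<integral>\<^sup>+k. s k \<partial>count_space UNIV) * (\<integral>\<^sup>+y. G y * indicator unit_cell y \<partial>lebesgue)"
proof -
  note [measurable] = borel_measurable_vfrac[OF G]
  have m: "(\<lambda>u. s (vfloor u) * G (vfrac u)) \<in> borel_measurable lebesgue"
    by measurable
  have "ennreal \<bar>det M\<bar> * (\<integral>\<^sup>+x. s (vfloor (M *v x)) * G (vfrac (M *v x)) \<partial>lebesgue)
      = (\<integral>\<^sup>+u. s (vfloor u) * G (vfrac u) \<partial>lebesgue)"
    using nn_integral_matrix_affine[OF M m, of 0] by simp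
  also have "\<dots> = (\<integral>\<^sup>+k. (\<integral>\<^sup>+y. s (vfloor (y + int_vec k)) * G (vfrac (y + int_vec k)) * indicator unit_cell y \<partial>lebesgue) \<partial>count_space UNIV)"
    by (rule nn_integral_tile[OF m])
  also have "\<dots> = (\<integral>\<^sup>+k. (\<integral>\<^sup>+y. s k * (G y * indicator unit_cell y) \<partial>lebesgue) \<partial>count_space UNIV)"
  proof -
    have "vfloor (y + int_vec k) = k" "vfrac (y + int_vec k) = y" if "y \<in> unit_cell" for y and k :: "int ^ 'd"
      using that vfloor_eq_iff[of "y + int_vec k" k] by (auto simp: vfrac_def)
    then show ?thesis
      by (intro nn_integral_cong) (auto simp: indicator_def)
  qed
  also have "\<dots> = (\<integral>\<^sup>+k. s k \<partial>count_space UNIV) * (\<integral>\<^sup>+y. G y * indicator unit_cell y \<partial>lebesgue)"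
    by (simp add: nn_integral_cmult nn_integral_multc)
  finally show ?thesis .
qed

lemma nn_integral_step:
  fixes M :: "real ^ 'd ^ 'd" and s :: "int ^ 'd \<Rightarrow> ennreal"
  assumes M: "invertible M"
  shows "ennreal \<bar>det M\<bar> * (\<integral>\<^sup>+x. s (vfloor (M *v x)) \<partial>lebesgue) = (\<integral>\<^sup>+k. s k \<partial>count_space UNIV)"
  using nn_integral_step_times_periodic[OF M, of "\<lambda>_. 1" s] by (simp add: emeasure_unit_cell)

lemma measurable_step:
  fixes M :: "real ^ 'd ^ 'd" and s :: "int ^ 'd \<Rightarrow> 'b::topological_space"
  assumes M: "invertible M"
  shows "(\<lambda>x. s (vfloor (M *v x))) \<in> borel_measurable lebesgue"
  using borel_measurable_matrix_affine[OF M, of "\<lambda>u. s (vfloor u)" 0] by simp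

text \<open>This is where independence of the scale comes from: the second factor enters only
  through its norm on one cell, whatever \<open>M\<close> is.\<close>

proposition Lp_le_step_times_periodic:
  fixes M :: "real ^ 'd ^ 'd" and G :: "real ^ 'd \<Rightarrow> 'b::{real_normed_field, second_countable_topology}" and s :: "int ^ 'd \<Rightarrow> 'b"
  assumes "1 \<le> p" and M: "invertible M" and s: "Lp_le p (\<lambda>x. s (vfloor (M *v x))) r"
    and G: "Lp_le p (\<lambda>y. indicator unit_cell y *\<^sub>R G y) q" "G \<in> borel_measurable lebesgue"
  shows "Lp_le p (\<lambda>x. s (vfloor (M *v x)) * G (vfrac (M *v x))) (r * q)"
proof -
  note [measurable] = G(2) borel_measurable_vfrac[OF G(2)] measurable_step[OF M]
  let ?S = "\<lambda>k. ennreal (norm (s k) powr p)" and ?G = "\<lambda>y. ennreal (norm (G y) powr p)"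
  have D: "ennreal \<bar>det M\<bar> \<noteq> 0" "ennreal \<bar>det M\<bar> \<noteq> \<infinity>"
    using M by (auto simp: invertible_det_nz)
  have rq: "0 \<le> r" "0 \<le> q" using s G by (auto simp: Lp_le_def)
  \<comment> \<open>The case of the constant second factor, \<open>nn_integral_step\<close>, turns
    the sum over \<open>k\<close> back into an integral of the step function. Both sides then carry
    the same nonzero finite determinant.\<close>
  have "ennreal \<bar>det M\<bar> * (\<integral>\<^sup>+x. ?S (vfloor (M *v x)) * ?G (vfrac (M *v x)) \<partial>lebesgue)
    = ennreal \<bar>det M\<bar> * ((\<integral>\<^sup>+x. ?S (vfloor (M *v x)) \<partial>lebesgue) * (\<integral>\<^sup>+y. ?G y * indicator unit_cell y \<partial>lebesgue))"
    using nn_integral_step_times_periodic[OF M, of ?G ?S] nn_integral_step[OF M, of ?S]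
    by (simp flip: mult.assoc)
  then have "(\<integral>\<^sup>+x. ?S (vfloor (M *v x)) * ?G (vfrac (M *v x)) \<partial>lebesgue)
    = (\<integral>\<^sup>+x. ?S (vfloor (M *v x)) \<partial>lebesgue) * (\<integral>\<^sup>+y. ?G y * indicator unit_cell y \<partial>lebesgue)"
    using D by (simp add: ennreal_mult_cancel_left)
  also have "(\<integral>\<^sup>+y. ?G y * indicator unit_cell y \<partial>lebesgue) = (\<integral>\<^sup>+y. ennreal (norm (indicator unit_cell y *\<^sub>R G y) powr p) \<partial>lebesgue)"
    by (intro nn_integral_cong) (auto simp: indicator_def)
  also have "(\<integral>\<^sup>+x. ?S (vfloor (M *v x)) \<partial>lebesgue) * \<dots> \<le> ennreal (r powr p) * ennreal (q powr p)"
    using s G by (intro mult_mono) (auto simp: Lp_le_def)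
  finally have "(\<integral>\<^sup>+x. ?S (vfloor (M *v x)) * ?G (vfrac (M *v x)) \<partial>lebesgue) \<le> ennreal ((r * q) powr p)"
    by (simp add: ennreal_mult powr_mult)
  moreover have "(\<lambda>x. G (vfrac (M *v x))) \<in> borel_measurable lebesgue"
    using borel_measurable_matrix_affine[OF M borel_measurable_vfrac[OF G(2)], of 0] by simp
  then have "(\<lambda>x. s (vfloor (M *v x)) * G (vfrac (M *v x))) \<in> borel_measurable lebesgue"
    by measurable
  ultimately show ?thesis
    using rq by (simp add: Lp_le_def norm_mult powr_mult ennreal_mult)
qed

lemma finite_bounded_int_vec: "finite {n :: int ^ 'd. \<forall>i. \<bar>n $ i\<bar> \<le> m}"
proof (rule finite_imageD)
  show "finite (vec_nth ` {n :: int ^ 'd. \<forall>i. \<bar>n $ i\<bar> \<le> m})"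
    by (rule finite_subset[OF _ finite_PiE[of UNIV "\<lambda>_. {-m..m}"]]) (auto simp: PiE_def abs_le_iff minus_le_iff)
qed (auto simp: inj_on_def vec_eq_iff)

subsection \<open>Small steps along a function of mean one\<close>

lemma norm_convex_combination_powr:
  fixes a b :: "'a::real_normed_vector"
  assumes "1 \<le> p" "0 \<le> s" "s \<le> 1"
  shows "norm ((1 - s) *\<^sub>R a + s *\<^sub>R b) powr p \<le> (1 - s) * norm a powr p + s * norm b powr p"
proof -
  have "norm ((1 - s) *\<^sub>R a + s *\<^sub>R b) powr p \<le> ((1 - s) * norm a + s * norm b) powr p"
    using assms by (intro powr_mono2 norm_triangle_le) auto
  also have "\<dots> \<le> (1 - s) * norm a powr p + s * norm b powr p"
    using convex_onD[OF convex_on_powr_nonneg[OF assms(1)] assms(2,3), of "norm a" "norm b"] by simp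
  finally show ?thesis .
qed

text \<open>h(t) = |1 - t z|^p is convex with h(0) = 1, so its difference quotients at 0 for 0 < t
  \<le> 1 lie between h(0) - h(-1) and h(1) - h(0).\<close>

lemma norm_powr_difference_quotient_bound:
  fixes z :: complex
  assumes "1 \<le> p" "0 < t" "t \<le> 1"
  shows "\<bar>(norm (1 - of_real t * z) powr p - 1) / t\<bar> \<le> norm (1 - z) powr p + norm (1 + z) powr p + 1"
proof -
  let ?h = "norm (1 - of_real t * z) powr p"
  have "(1 - t) *\<^sub>R 1 + t *\<^sub>R (1 - z) = 1 - of_real t * z"
    by (simp add: scaleR_conv_of_real algebra_simps)
  with norm_convex_combination_powr[OF assms(1), of t 1 "1 - z"] assms
  have "?h - 1 \<le> t * (norm (1 - z) powr p - 1)"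
    by (simp add: right_diff_distrib)
  then have up: "(?h - 1) / t \<le> norm (1 - z) powr p - 1"
    using assms by (simp add: divide_le_eq mult.commute)
  \<comment> \<open>This weight makes 0 the convex combination of the parameters t and -1, that is,
    (1 - s) t = s.\<close>
  define s where "s = t / (1 + t)"
  have s: "0 \<le> s" "s \<le> 1" "1 - s = 1 / (1 + t)" "(1 + t) * s = t" "(1 + t) * (1 - s) = 1"
    using assms by (auto simp: s_def field_simps)
  have "(1 - s) *\<^sub>R (1 - of_real t * z) + s *\<^sub>R (1 + z) = 1 + of_real (s - (1 - s) * t) * z"
    by (simp add: scaleR_conv_of_real algebra_simps)
  moreover have "s - (1 - s) * t = 0"
    unfolding s(3) by (simp add: s_def)
  ultimately have "1 \<le> (1 - s) * ?h + s * norm (1 + z) powr p"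
    using norm_convex_combination_powr[OF assms(1) s(1,2), of "1 - of_real t * z" "1 + z"] by simp
  then have "(1 + t) * 1 \<le> (1 + t) * ((1 - s) * ?h + s * norm (1 + z) powr p)"
    using assms by (intro mult_left_mono) auto
  also have "\<dots> = ((1 + t) * (1 - s)) * ?h + ((1 + t) * s) * norm (1 + z) powr p"
    by (simp add: algebra_simps)
  finally have "t * (1 - norm (1 + z) powr p) \<le> ?h - 1"
    unfolding s(4,5) by (simp add: algebra_simps)
  then have lo: "1 - norm (1 + z) powr p \<le> (?h - 1) / t"
    using assms by (simp add: le_divide_eq mult.commute)
  have "0 \<le> norm (1 - z) powr p" "0 \<le> norm (1 + z) powr p"
    by auto
  with up lo show ?thesis
    by (intro abs_leI) linarith+
qed

text \<open>In real and imaginary parts the squared norm is a polynomial in t with value 1 at t = 0,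
  so its power p/2 is differentiable there; the chain rule gives (p/2)(-2 Re z).\<close>

lemma norm_powr_difference_quotient_tendsto:
  fixes z :: complex
  assumes "1 \<le> p"
  shows "(\<lambda>n. (norm (1 - of_real (inverse (real (Suc n))) * z) powr p - 1) / inverse (real (Suc n))) \<longlonglongrightarrow> - p * Re z"
proof -
  let ?f = "\<lambda>t. ((1 - t * Re z)\<^sup>2 + (t * Im z)\<^sup>2) powr (p / 2)"
  have f: "norm (1 - of_real t * z) powr p = ?f t" for t
  proof -
    have "norm (1 - of_real t * z) = ((1 - t * Re z)\<^sup>2 + (t * Im z)\<^sup>2) powr (1/2)"
      by (simp add: cmod_def powr_half_sqrt)
    then show ?thesis
      by (simp add: powr_powr)
  qed
  have "(?f has_real_derivative - p * Re z) (at 0)"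
    using assms by (auto intro!: derivative_eq_intros)
  then have "((\<lambda>t. (?f t - 1) / t) \<longlongrightarrow> - p * Re z) (at 0)"
    by (simp add: has_field_derivative_iff)
  moreover have "filterlim (\<lambda>n. inverse (real (Suc n))) (at 0) sequentially"
    by (rule filterlim_atI[OF LIMSEQ_inverse_real_of_nat]) simp
  ultimately have "(\<lambda>n. (?f (inverse (real (Suc n))) - 1) / inverse (real (Suc n))) \<longlonglongrightarrow> - p * Re z"
    by (rule filterlim_compose)
  then show ?thesis
    by (simp only: f)
qed

lemma powr_add_le:
  assumes "0 \<le> (p::real)" "0 \<le> a" "0 \<le> b"
  shows "(a + b) powr p \<le> 2 powr p * (a powr p + b powr p)"
proof -
  have "(a + b) powr p \<le> (2 * max a b) powr p"
    using assms by (intro powr_mono2) auto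
  also have "\<dots> = 2 powr p * max a b powr p"
    by (rule powr_mult)
  also have "\<dots> \<le> 2 powr p * (a powr p + b powr p)"
    by (intro mult_left_mono) (auto simp: max_def)
  finally show ?thesis .
qed

text \<open>The reason is \<open>\<integral>\<bar>1 - t \<Phi>\<bar>\<^sup>p = 1 - p t + o(t)\<close>; convexity in \<open>t\<close> dominates the difference quotients.\<close>

proposition small_step_contracts:
  fixes \<Phi> :: "'a \<Rightarrow> complex"
  assumes "1 \<le> p" and "finite_measure P" "measure P (space P) = 1"
    and [measurable]: "\<Phi> \<in> borel_measurable P" and int: "integrable P (\<lambda>x. norm (\<Phi> x) powr p)"
    and mean: "(LINT x|P. \<Phi> x) = 1"
  shows "\<exists>t>0. integrable P (\<lambda>x. norm (1 - of_real t * \<Phi> x) powr p) \<and> (LINT x|P. norm (1 - of_real t * \<Phi> x) powr p) < 1"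
proof -
  interpret finite_measure P by fact
  have intb: "integrable P (\<lambda>x. norm (1 + c * \<Phi> x) powr p)" for c
  proof (rule Bochner_Integration.integrable_bound)
    show "integrable P (\<lambda>x. 2 powr p * (1 + norm c powr p * norm (\<Phi> x) powr p))"
      using int by simp
    show "AE x in P. norm (norm (1 + c * \<Phi> x) powr p) \<le> norm (2 powr p * (1 + norm c powr p * norm (\<Phi> x) powr p))"
    proof (rule AE_I2)
      fix x
      have "norm (1 + c * \<Phi> x) powr p \<le> (1 + norm c * norm (\<Phi> x)) powr p"
        using assms(1) norm_triangle_ineq[of 1 "c * \<Phi> x"] by (intro powr_mono2) (auto simp: norm_mult)
      also have "\<dots> \<le> 2 powr p * (1 powr p + (norm c * norm (\<Phi> x)) powr p)"
        using assms(1) by (intro powr_add_le) auto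
      finally show "norm (norm (1 + c * \<Phi> x) powr p) \<le> norm (2 powr p * (1 + norm c powr p * norm (\<Phi> x) powr p))"
        by (simp add: powr_mult)
    qed
  qed measurable
  define t where "t n = inverse (real (Suc n))" for n
  have t: "0 < t n" "t n \<le> 1" for n
    by (auto simp: t_def inverse_le_1_iff)
  have intt: "integrable P (\<lambda>x. norm (1 - of_real (t n) * \<Phi> x) powr p)" for n
    using intb[of "- of_real (t n)"] by simp
  have "integrable P \<Phi>"
  proof (rule Bochner_Integration.integrable_bound)
    show "integrable P (\<lambda>x. 1 + norm (\<Phi> x) powr p)"
      using int by simp
    \<comment> \<open>On a finite measure space this puts L^p inside L^1, so the mean is a genuine
      integral.\<close>
    have "u \<le> 1 + u powr p" if "0 \<le> u" for u :: real
    proof (cases "u \<le> 1")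
      case False
      then have "u powr 1 \<le> u powr p" using assms(1) by (intro powr_mono) auto
      then show ?thesis using False by simp
    qed (simp add: add_increasing2)
    then show "AE x in P. norm (\<Phi> x) \<le> norm (1 + norm (\<Phi> x) powr p)"
      by simp
  qed measurable
  then have "(LINT x|P. - p * Re (\<Phi> x)) = - p * Re (LINT x|P. \<Phi> x)"
    by (simp add: integral_Re)
  then have neg: "(LINT x|P. - p * Re (\<Phi> x)) < 0"
    using assms(1) mean by simp
  have "(\<lambda>n. LINT x|P. (norm (1 - of_real (t n) * \<Phi> x) powr p - 1) / t n) \<longlonglongrightarrow> (LINT x|P. - p * Re (\<Phi> x))"
  proof (rule integral_dominated_convergence)
    show "integrable P (\<lambda>x. norm (1 - \<Phi> x) powr p + norm (1 + \<Phi> x) powr p + 1)"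
      using intb[of 1] intb[of "-1"] by simp
    show "AE x in P. (\<lambda>n. (norm (1 - of_real (t n) * \<Phi> x) powr p - 1) / t n) \<longlonglongrightarrow> - p * Re (\<Phi> x)"
      using norm_powr_difference_quotient_tendsto[OF assms(1)] by (simp add: t_def)
    show "AE x in P. norm ((norm (1 - of_real (t n) * \<Phi> x) powr p - 1) / t n) \<le> norm (1 - \<Phi> x) powr p + norm (1 + \<Phi> x) powr p + 1" for n
      using norm_powr_difference_quotient_bound[OF assms(1) t] by simp
  qed measurable
  \<comment> \<open>The integrated quotients tend to -p times the real part of the mean, which is -p
    < 0, so one of them is already negative and its \<open>t n\<close> is the witness.\<close>
  from order_tendstoD(2)[OF this neg]
  obtain n where "(LINT x|P. (norm (1 - of_real (t n) * \<Phi> x) powr p - 1) / t n) < 0"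
    unfolding eventually_sequentially by blast
  moreover have "(LINT x|P. (norm (1 - of_real (t n) * \<Phi> x) powr p - 1) / t n)
      = ((LINT x|P. norm (1 - of_real (t n) * \<Phi> x) powr p) - 1) / t n"
    using intt[of n] assms(3) by simp
  ultimately have "(LINT x|P. norm (1 - of_real (t n) * \<Phi> x) powr p) < 1"
    using t(1)[of n] by (simp add: divide_less_0_iff)
  then show ?thesis
    using t(1)[of n] intt[of n] by blast
qed

text \<open>The probability space is the unit cell with restricted Lebesgue measure, and
  \<open>q\<close> is the p-th root of the contracted integral.\<close>

corollary unit_cell_small_step_contracts:
  fixes \<Phi> :: "real ^ 'd \<Rightarrow> complex"
  assumes "1 \<le> p" and \<Phi>: "Lp_le p (\<lambda>y. indicator unit_cell y *\<^sub>R \<Phi> y) r" "\<Phi> \<in> borel_measurable lebesgue"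
    and mean: "(LINT y|lebesgue. indicator unit_cell y *\<^sub>R \<Phi> y) = 1"
  obtains t q where "0 < t" "0 \<le> q" "q < 1" "Lp_le p (\<lambda>y. indicator unit_cell y *\<^sub>R (1 - of_real t * \<Phi> y)) q"
proof -
  define P where "P = lebesgue_on (unit_cell :: (real ^ 'd) set)"
  have "emeasure P (space P) = 1"
    by (simp add: P_def emeasure_restrict_space emeasure_unit_cell)
  then have P: "finite_measure P" "measure P (space P) = 1"
    by (auto simp: measure_def intro: finite_measureI)
  have meas: "\<Phi> \<in> borel_measurable P"
    unfolding P_def by (rule measurable_restrict_space1[OF \<Phi>(2)])
  have eq: "indicator unit_cell y *\<^sub>R (norm (g y) powr p) = norm (indicator unit_cell y *\<^sub>R g y) powr p"
    for y and g :: "real ^ 'd \<Rightarrow> complex"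
    by (simp add: indicator_def)
  have int_iff: "integrable P (\<lambda>x. norm (g x) powr p) \<longleftrightarrow> integrable lebesgue (\<lambda>y. norm (indicator unit_cell y *\<^sub>R g y) powr p)"
    for g :: "real ^ 'd \<Rightarrow> complex"
    unfolding P_def by (subst integrable_restrict_space) (simp_all only: eq, simp_all)
  have lint: "(LINT x|P. norm (g x) powr p) = (LINT y|lebesgue. norm (indicator unit_cell y *\<^sub>R g y) powr p)"
    for g :: "real ^ 'd \<Rightarrow> complex"
    unfolding P_def by (subst integral_restrict_space) (simp_all only: eq, simp_all)
  have "integrable P (\<lambda>x. norm (\<Phi> x) powr p)"
    using \<Phi>(1) by (simp add: int_iff Lp_le_iff[OF assms(1)] Lp_def)
  moreover have "(LINT x|P. \<Phi> x) = 1"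
    unfolding P_def using mean by (subst integral_restrict_space) simp_all
  ultimately obtain t where t: "0 < t" "integrable P (\<lambda>x. norm (1 - of_real t * \<Phi> x) powr p)"
    "(LINT x|P. norm (1 - of_real t * \<Phi> x) powr p) < 1"
    using small_step_contracts[OF assms(1) P meas] by blast
  define I where "I = (LINT x|P. norm (1 - of_real t * \<Phi> x) powr p)"
  have I: "0 \<le> I" "I < 1"
    using t(3) by (auto simp: I_def intro: integral_nonneg_AE)
  show thesis
  proof (rule that[of t "I powr (1/p)"])
    show "I powr (1/p) < 1"
      using I assms(1) powr_less_mono2[of "1/p" I 1] by simp
    have "(\<lambda>y. indicator unit_cell y *\<^sub>R (1 - of_real t * \<Phi> y)) \<in> borel_measurable lebesgue"
      using \<Phi>(2) by measurable
    moreover have "(\<integral>\<^sup>+y. ennreal (norm (indicator unit_cell y *\<^sub>R (1 - of_real t * \<Phi> y)) powr p) \<partial>lebesgue) = ennreal I"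
      unfolding I_def lint using t(2) by (intro nn_integral_eq_integral) (simp_all only: int_iff, simp)
    ultimately show "Lp_le p (\<lambda>y. indicator unit_cell y *\<^sub>R (1 - of_real t * \<Phi> y)) (I powr (1/p))"
      using I assms(1) by (simp add: Lp_le_def powr_powr)
  qed (use t in auto)
qed

subsection \<open>Lattice translates of a compactly supported function\<close>

lemma integral_matrix_affine:
  fixes A :: "real ^ 'd ^ 'd" and g :: "real ^ 'd \<Rightarrow> 'b::{banach, second_countable_topology}"
  assumes A: "invertible A" and g: "g \<in> borel_measurable lebesgue"
  shows "(LINT x|lebesgue. g x) = \<bar>det A\<bar> *\<^sub>R (LINT x|lebesgue. g (A *v x + v))"
  using measurable_lebesgue_matrix_affine[OF A, of v] g
  by (subst lebesgue_matrix_affine[OF A, of v]) (simp add: integral_density integral_distr)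

lemma integrable_lebesgue_shift:
  fixes g :: "real ^ 'd \<Rightarrow> 'b::{banach, second_countable_topology}"
  assumes g: "integrable lebesgue g"
  shows "integrable lebesgue (\<lambda>x. g (x + v))"
proof (rule integrableI_bounded)
  have [measurable]: "g \<in> borel_measurable lebesgue" using g by simp
  show "(\<lambda>x. g (x + v)) \<in> borel_measurable lebesgue"
    by (rule borel_measurable_lebesgue_shift) simp
  have "(\<lambda>x. ennreal (norm (g x))) \<in> borel_measurable lebesgue"
    by measurable
  from nn_integral_lebesgue_shift[OF this, of v] show "(\<integral>\<^sup>+x. ennreal (norm (g (x + v))) \<partial>lebesgue) < \<infinity>"
    using g by (simp add: integrable_iff_bounded)
qed

lemma Lp_le_shift:
  fixes g :: "real ^ 'd \<Rightarrow> 'b::real_normed_vector"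
  assumes "Lp_le p g r"
  shows "Lp_le p (\<lambda>x. g (x + v)) r"
proof -
  have g: "g \<in> borel_measurable lebesgue" using assms by (simp add: Lp_le_def)
  then have "(\<lambda>x. ennreal (norm (g x) powr p)) \<in> borel_measurable lebesgue"
    by measurable
  then show ?thesis
    using assms nn_integral_lebesgue_shift[of "\<lambda>x. ennreal (norm (g x) powr p)" v] borel_measurable_lebesgue_shift[OF g, of v]
    by (simp add: Lp_le_def)
qed

lemma nn_integral_count_space_eq_infsum:
  fixes f :: "'a \<Rightarrow> real"
  assumes "f summable_on UNIV" "\<And>x. 0 \<le> f x"
  shows "(\<integral>\<^sup>+x. ennreal (f x) \<partial>count_space UNIV) = ennreal (\<Sum>\<^sub>\<infinity>x. f x)"
proof -
  have "Infinite_Set_Sum.abs_summable_on f UNIV"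
    using assms by (simp flip: abs_summable_equivalent)
  then show ?thesis
    using assms by (simp add: nn_integral_conv_infsetsum infsetsum_infsum)
qed

text \<open>The support condition is required at every point and not just almost everywhere: lattice
  sums are then finite sums pointwise.\<close>

locale bump =
  fixes p :: real and \<phi> :: "real ^ 'd \<Rightarrow> complex" and r R :: real
  assumes p: "1 \<le> p" and Lp: "Lp_le p \<phi> r" and R: "0 \<le> R" and bounded_support: "\<And>y. \<phi> y \<noteq> 0 \<Longrightarrow> norm y \<le> R"
    and mean: "(LINT y|lebesgue. \<phi> y) = 1"
begin

text \<open>Contains every \<open>n\<close> for which the translate by \<open>n\<close> can be
  nonzero on the unit cell; the added 1 pays for the side of the cell. Its cardinality is the
  overlap count in all later bounds.\<close>

definition window :: "(int ^ 'd) set" where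
  "window = {n. \<forall>i. \<bar>n $ i\<bar> \<le> \<lceil>R\<rceil> + 1}"

text \<open>On the unit cell this finite sum is the full lattice sum, by
  \<open>window_complete\<close>. It is therefore used only on the cell or at fractional
  parts.\<close>

definition periodization :: "real ^ 'd \<Rightarrow> complex" where
  "periodization y = (\<Sum>n\<in>window. \<phi> (y + int_vec n))"

definition abs_periodization :: "real ^ 'd \<Rightarrow> real" where
  "abs_periodization y = (\<Sum>n\<in>window. norm (\<phi> (y + int_vec n)))"

text \<open>The sum of c k times \<phi>(M x - k), reindexed by n = floor(M x) - k: finitely many
  terms, each a step function times a function of the fractional part.\<close>

definition scale_synth :: "real ^ 'd ^ 'd \<Rightarrow> (int ^ 'd \<Rightarrow> complex) \<Rightarrow> real ^ 'd \<Rightarrow> complex" where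
  "scale_synth M c x = (\<Sum>n\<in>window. c (vfloor (M *v x) - n) * \<phi> (vfrac (M *v x) + int_vec n))"

lemma finite_window: "finite window"
  unfolding window_def by (rule finite_bounded_int_vec)

lemma meas: "\<phi> \<in> borel_measurable lebesgue"
  using Lp by (simp add: Lp_le_def)

lemma meas_shift: "(\<lambda>y. \<phi> (y + v)) \<in> borel_measurable lebesgue"
  by (rule borel_measurable_lebesgue_shift[OF meas])

lemma r_nonneg: "0 \<le> r"
  using Lp by (simp add: Lp_le_def)

lemma window_complete:
  assumes "y \<in> unit_cell" "\<phi> (y + int_vec n) \<noteq> 0"
  shows "n \<in> window"
proof -
  have "\<bar>n $ i\<bar> \<le> \<lceil>R\<rceil> + 1" for i
  proof -
    have "\<bar>y $ i + real_of_int (n $ i)\<bar> \<le> R"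
      using component_le_norm_cart[of "y + int_vec n" i] bounded_support[OF assms(2)]
      by (simp add: int_vec_def)
    moreover have "0 \<le> y $ i" "y $ i < 1"
      using assms(1) by (auto simp: unit_cell_def)
    ultimately have "\<bar>real_of_int (n $ i)\<bar> \<le> real_of_int (\<lceil>R\<rceil> + 1)"
      using le_of_int_ceiling[of R] by simp linarith
    then show ?thesis by linarith
  qed
  then show ?thesis by (simp add: window_def)
qed

lemma Lp_le_cell_shift:
  "Lp_le p (\<lambda>y. indicator unit_cell y *\<^sub>R \<phi> (y + v)) r"
proof (rule Lp_le_dominated[OF Lp_le_shift[OF Lp, of v]])
  show "(\<lambda>y. indicator unit_cell y *\<^sub>R \<phi> (y + v)) \<in> borel_measurable lebesgue"
    using meas_shift by measurable
qed (use p in \<open>auto simp: indicator_def\<close>)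

lemma periodization_measurable: "periodization \<in> borel_measurable lebesgue"
  unfolding periodization_def[abs_def] by (intro borel_measurable_sum meas_shift)

lemma abs_periodization_measurable: "abs_periodization \<in> borel_measurable lebesgue"
  unfolding abs_periodization_def[abs_def] by (intro borel_measurable_sum measurable_compose[OF meas_shift borel_measurable_norm])

lemma Lp_le_periodization:
  "Lp_le p (\<lambda>y. indicator unit_cell y *\<^sub>R periodization y) (real (card window) * r)"
proof -
  have "Lp_le p (\<lambda>y. \<Sum>n\<in>window. indicator unit_cell y *\<^sub>R \<phi> (y + int_vec n)) (\<Sum>n\<in>window. r)"
    by (rule Lp_le_sum[OF p Lp_le_cell_shift])
  then show ?thesis
    by (simp add: periodization_def scaleR_sum_right)
qed

lemma Lp_le_abs_periodization:
  "Lp_le p (\<lambda>y. indicator unit_cell y *\<^sub>R abs_periodization y) (real (card window) * r)"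
proof -
  have "Lp_le p (\<lambda>y. indicator unit_cell y *\<^sub>R norm (\<phi> (y + v))) r" for v
  proof (rule Lp_le_dominated[OF Lp_le_cell_shift])
    show "(\<lambda>y. indicator unit_cell y *\<^sub>R norm (\<phi> (y + v))) \<in> borel_measurable lebesgue"
      using meas_shift by measurable
  qed (use p in auto)
  then have "Lp_le p (\<lambda>y. \<Sum>n\<in>window. indicator unit_cell y *\<^sub>R norm (\<phi> (y + int_vec n))) (\<Sum>n\<in>window. r)"
    by (rule Lp_le_sum[OF p])
  then show ?thesis
    by (simp add: abs_periodization_def sum_distrib_left)
qed

text \<open>On a ball of finite measure u \<le> 1 + u^p gives a majorant; outside it the function is
  zero.\<close>

lemma \<phi>_integrable: "integrable lebesgue \<phi>"
proof (rule Bochner_Integration.integrable_bound)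
  show "integrable lebesgue (\<lambda>x. indicator (cball 0 R) x + norm (\<phi> x) powr p)"
  proof (rule Bochner_Integration.integrable_add)
    show "integrable lebesgue (indicat_real (cball (0 :: real ^ 'd) R))"
      using lmeasurable_cball[of "0 :: real ^ 'd" R] by (intro integrable_real_indicator) (auto simp: fmeasurable_def)
    show "integrable lebesgue (\<lambda>x. norm (\<phi> x) powr p)"
      using Lp by (simp add: Lp_le_iff[OF p] Lp_def)
  qed
  have "u \<le> 1 + u powr p" if "0 \<le> u" for u :: real
  proof (cases "u \<le> 1")
    case False
    then have "u powr 1 \<le> u powr p" using p by (intro powr_mono) auto
    then show ?thesis using False by simp
  qed (simp add: add_increasing2)
  then have "norm (\<phi> x) \<le> norm (indicat_real (cball 0 R) x + norm (\<phi> x) powr p)" for x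
    using bounded_support[of x] by (cases "\<phi> x = 0") (auto simp: indicator_def)
  then show "AE x in lebesgue. norm (\<phi> x) \<le> norm (indicat_real (cball 0 R) x + norm (\<phi> x) powr p)"
    by simp
qed (rule meas)

lemma mean_periodization: "(LINT y|lebesgue. indicator unit_cell y *\<^sub>R periodization y) = 1"
proof -
  have int: "integrable lebesgue (\<lambda>x. indicator unit_cell (x + - int_vec n) *\<^sub>R \<phi> x)" for n
  proof (rule Bochner_Integration.integrable_bound[OF \<phi>_integrable])
    show "(\<lambda>x. indicator unit_cell (x + - int_vec n) *\<^sub>R \<phi> x) \<in> borel_measurable lebesgue"
      by (intro borel_measurable_scaleR meas borel_measurable_lebesgue_shift[of "indicat_real unit_cell"]) measurable
  qed (auto simp: indicator_def)
  have shift: "(LINT x|lebesgue. indicator unit_cell (x + - int_vec n) *\<^sub>R \<phi> x) = (LINT y|lebesgue. indicator unit_cell y *\<^sub>R \<phi> (y + int_vec n))" for n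
    using integral_matrix_affine[OF invertible_mat_1 borel_measurable_integrable[OF int[of n]], of "int_vec n"] by simp
  \<comment> \<open>Unfolding: of the shifted cells only the one containing \<open>x\<close>
    contributes, and its index lies in the window whenever the value is nonzero.\<close>
  have "\<phi> x = (\<Sum>n\<in>window. indicator unit_cell (x + - int_vec n) *\<^sub>R \<phi> x)" for x
  proof (cases "\<phi> x = 0")
    case False
    then have "vfloor x \<in> window"
      using window_complete[OF vfrac_in_unit_cell, of x "vfloor x"] vfloor_plus_vfrac[of x] by (simp add: add.commute)
    moreover have "indicator unit_cell (x + - int_vec n) *\<^sub>R \<phi> x = (if n = vfloor x then \<phi> x else 0)" for n
      using vfloor_eq_iff[of x n] by (auto simp: indicator_def)
    ultimately show ?thesis
      by (simp add: finite_window)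
  qed simp
  then have "(LINT x|lebesgue. \<phi> x) = (LINT x|lebesgue. (\<Sum>n\<in>window. indicator unit_cell (x + - int_vec n) *\<^sub>R \<phi> x))"
    by simp
  also have "\<dots> = (\<Sum>n\<in>window. LINT y|lebesgue. indicator unit_cell y *\<^sub>R \<phi> (y + int_vec n))"
    using int by (simp only: Bochner_Integration.integral_sum shift)
  also have "\<dots> = (LINT y|lebesgue. (\<Sum>n\<in>window. indicator unit_cell y *\<^sub>R \<phi> (y + int_vec n)))"
  proof (rule Bochner_Integration.integral_sum[symmetric])
    fix n
    have "integrable lebesgue (\<lambda>y. \<phi> (y + int_vec n))"
      by (rule integrable_lebesgue_shift[OF \<phi>_integrable])
    then show "integrable lebesgue (\<lambda>y. indicator unit_cell y *\<^sub>R \<phi> (y + int_vec n))"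
      by (rule Bochner_Integration.integrable_bound) (use meas_shift in \<open>measurable, auto simp: indicator_def\<close>)
  qed
  finally show ?thesis
    by (simp add: mean periodization_def scaleR_sum_right)
qed

lemma translates_sum:
  "(\<lambda>k. norm (c k * \<phi> (M *v x - int_vec k))) summable_on UNIV"
  "(\<Sum>\<^sub>\<infinity>k. c k * \<phi> (M *v x - int_vec k)) = scale_synth M c x"
proof -
  let ?u = "M *v x"
  have eq: "\<phi> (?u - int_vec (vfloor ?u - n)) = \<phi> (vfrac ?u + int_vec n)" for n
    by (simp add: vfrac_def int_vec_diff algebra_simps)
  have zero: "\<phi> (?u - int_vec k) = 0" if "k \<notin> (\<lambda>n. vfloor ?u - n) ` window" for k
  proof (rule ccontr)
    assume "\<phi> (?u - int_vec k) \<noteq> 0"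
    then have "vfloor ?u - k \<in> window"
      using window_complete[OF vfrac_in_unit_cell, of ?u "vfloor ?u - k"] eq[of "vfloor ?u - k"] by simp
    then have "k \<in> (\<lambda>n. vfloor ?u - n) ` window"
      by (intro image_eqI[of _ _ "vfloor ?u - k"]) simp_all
    with that show False ..
  qed
  have fin: "finite ((\<lambda>n. vfloor ?u - n) ` window)"
    by (simp add: finite_window)
  have "(\<lambda>k. norm (c k * \<phi> (?u - int_vec k))) summable_on ((\<lambda>n. vfloor ?u - n) ` window)"
    using fin by (rule summable_on_finite)
  then show "(\<lambda>k. norm (c k * \<phi> (?u - int_vec k))) summable_on UNIV"
    by (rule summable_on_cong_neutral[THEN iffD1, rotated 3]) (use zero in auto)
  have "(\<Sum>\<^sub>\<infinity>k. c k * \<phi> (?u - int_vec k)) = (\<Sum>\<^sub>\<infinity>k\<in>(\<lambda>n. vfloor ?u - n) ` window. c k * \<phi> (?u - int_vec k))"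
    by (rule infsum_cong_neutral) (use zero in auto)
  also have "\<dots> = (\<Sum>k\<in>(\<lambda>n. vfloor ?u - n) ` window. c k * \<phi> (?u - int_vec k))"
    using fin by simp
  also have "\<dots> = scale_synth M c x"
    by (subst sum.reindex) (auto simp: inj_on_def scale_synth_def eq)
  finally show "(\<Sum>\<^sub>\<infinity>k. c k * \<phi> (?u - int_vec k)) = scale_synth M c x" .
qed

text \<open>Each \<open>n\<close> in the window contributes a step function times a fixed profile on
  the cell. Shifting the index by \<open>n\<close> leaves the coefficient norm unchanged, so
  Minkowski's inequality costs only the factor \<open>card window\<close>.\<close>

lemma Lp_le_scale_synth:
  assumes M: "invertible M" and c: "(\<lambda>k. norm (c k) powr p) summable_on UNIV"
  shows "Lp_le p (scale_synth M c)
    (real (card window) * r * (\<bar>det M\<bar> powr (-1/p) * (\<Sum>\<^sub>\<infinity>k. norm (c k) powr p) powr (1/p)))"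
proof -
  define C where "C = (\<Sum>\<^sub>\<infinity>k. norm (c k) powr p)"
  have C: "0 \<le> C"
    unfolding C_def by (rule infsum_nonneg) simp
  have D: "\<bar>det M\<bar> > 0" using M by (simp add: invertible_det_nz)
  have "Lp_le p (\<lambda>x. c (vfloor (M *v x) - n)) (\<bar>det M\<bar> powr (-1/p) * C powr (1/p))" for n
  proof -
    have "bij_betw (\<lambda>k. k - n) UNIV UNIV"
      by (rule bij_betwI[where g = "\<lambda>k. k + n"]) auto
    then have "(\<integral>\<^sup>+k. ennreal (norm (c (k - n)) powr p) \<partial>count_space UNIV) = (\<integral>\<^sup>+k. ennreal (norm (c k) powr p) \<partial>count_space UNIV)"
      by (rule nn_integral_bij_count_space)
    also have "\<dots> = ennreal C"
      unfolding C_def using c by (simp add: nn_integral_count_space_eq_infsum)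
    finally have "ennreal \<bar>det M\<bar> * (\<integral>\<^sup>+x. ennreal (norm (c (vfloor (M *v x) - n)) powr p) \<partial>lebesgue) = ennreal C"
      using nn_integral_step[OF M, of "\<lambda>k. ennreal (norm (c (k - n)) powr p)"] by simp
    then have "ennreal \<bar>det M\<bar> * (\<integral>\<^sup>+x. ennreal (norm (c (vfloor (M *v x) - n)) powr p) \<partial>lebesgue) = ennreal \<bar>det M\<bar> * ennreal (C / \<bar>det M\<bar>)"
      using D C by (simp flip: ennreal_mult)
    then have "(\<integral>\<^sup>+x. ennreal (norm (c (vfloor (M *v x) - n)) powr p) \<partial>lebesgue) = ennreal (C / \<bar>det M\<bar>)"
      using D by (simp add: ennreal_mult_cancel_left)
    moreover have "(\<bar>det M\<bar> powr (-1/p) * C powr (1/p)) powr p = C / \<bar>det M\<bar>"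
    proof -
      have "(\<bar>det M\<bar> powr (-1/p)) powr p = inverse \<bar>det M\<bar>"
        unfolding powr_powr using p D by (simp add: powr_minus)
      moreover have "(C powr (1/p)) powr p = C"
        unfolding powr_powr using p C by simp
      ultimately show ?thesis
        by (simp add: powr_mult divide_inverse mult.commute)
    qed
    ultimately show ?thesis
      using measurable_step[OF M, of "\<lambda>k. c (k - n)"] by (simp add: Lp_le_def)
  qed
  then have "Lp_le p (\<lambda>x. \<Sum>n\<in>window. c (vfloor (M *v x) - n) * \<phi> (vfrac (M *v x) + int_vec n))
      (\<Sum>n\<in>window. (\<bar>det M\<bar> powr (-1/p) * C powr (1/p)) * r)"
    by (intro Lp_le_sum[OF p] Lp_le_step_times_periodic[OF p M, of "\<lambda>k. c (k - n)" for n] Lp_le_cell_shift meas_shift)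
  then show ?thesis
    by (simp add: scale_synth_def[abs_def] C_def mult_ac)
qed

end

section \<open>Sampling a continuous function on a fine lattice\<close>

lemma uniformly_continuous_compact_support:
  fixes f :: "'a::euclidean_space \<Rightarrow> 'b::real_normed_vector"
  assumes f: "continuous_on UNIV f" and supp: "\<And>x. f x \<noteq> 0 \<Longrightarrow> norm x \<le> S" and "0 < e"
  obtains d where "0 < d" "d \<le> 1" "\<And>x y. dist x y < d \<Longrightarrow> norm (f x - f y) \<le> e"
proof -
  have "uniformly_continuous_on (cball 0 (S + 1)) f"
    by (intro compact_uniformly_continuous continuous_on_subset[OF f]) auto
  then obtain d where d: "0 < d" "\<And>x y. x \<in> cball 0 (S+1) \<Longrightarrow> y \<in> cball 0 (S+1) \<Longrightarrow> dist y x < d \<Longrightarrow> dist (f y) (f x) < e"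
    using \<open>0 < e\<close> unfolding uniformly_continuous_on_def by blast
  show thesis
  \<comment> \<open>With distance below 1, if one point leaves the ball of radius S+1 then both lie
    outside radius S, where \<open>f\<close> vanishes.\<close>
  proof (rule that[of "min d 1"])
    fix x y :: 'a assume xy: "dist x y < min d 1"
    have n: "norm x \<le> norm y + dist x y" "norm y \<le> norm x + dist x y"
      using norm_triangle_sub[of x y] norm_triangle_sub[of y x] by (simp_all add: dist_norm norm_minus_commute)
    show "norm (f x - f y) \<le> e"
    proof (cases "norm x \<le> S + 1 \<and> norm y \<le> S + 1")
      case True
      then show ?thesis
        using d(2)[of y x] xy by (simp add: dist_norm)
    next
      case False
      then have "f x = 0" "f y = 0"
        using supp[of x] supp[of y] n xy by force+
      then show ?thesis using \<open>0 < e\<close> by simp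
    qed
  qed (use d in auto)
qed

lemma norm_unit_cell_le: "y \<in> unit_cell \<Longrightarrow> norm (y :: real ^ 'd) \<le> real CARD('d)"
  using norm_le_l1_cart[of y] sum_bounded_above[of UNIV "\<lambda>i. \<bar>y $ i\<bar>" 1]
  by (force simp: unit_cell_def abs_le_iff intro: less_imp_le order_trans)

context bump
begin

lemma norm_window_le: "n \<in> window \<Longrightarrow> norm (int_vec n :: real ^ 'd) \<le> real CARD('d) * (\<lceil>R\<rceil> + 1)"
proof -
  assume n: "n \<in> window"
  have "\<bar>int_vec n $ i\<bar> \<le> real_of_int (\<lceil>R\<rceil> + 1)" for i
    using n unfolding window_def int_vec_def by simp (metis of_int_1 of_int_abs of_int_add of_int_le_iff)
  then show ?thesis
    using norm_le_l1_cart[of "int_vec n"] sum_bounded_above[of UNIV "\<lambda>i. \<bar>int_vec n $ i\<bar>" "real_of_int (\<lceil>R\<rceil> + 1)"]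
    by force
qed

text \<open>Let g k be the sampled value and k(x) the cell index of x. The residual is [f - g(k(x))]
  + g(k(x)) [1 - t \<Phi>] + E, where E collects the differences between samples in neighbouring
  cells. The middle term obeys the exact product bound; uniform continuity makes the other two
  small. The threshold \<eta> is chosen before \<open>M\<close> and \<open>B\<close>.\<close>

proposition sampling_approximation:
  fixes f :: "real ^ 'd \<Rightarrow> complex"
  assumes f: "continuous_on UNIV f" and supp: "\<And>x. f x \<noteq> 0 \<Longrightarrow> norm x \<le> S" and fN: "Lp_le p f N"
    and t: "0 < t" and q: "Lp_le p (\<lambda>y. indicator unit_cell y *\<^sub>R (1 - of_real t * periodization y)) q"
    and "0 < e"
  obtains \<eta> where "0 < \<eta>"
    "\<And>M B :: real ^ 'd ^ 'd. \<lbrakk>invertible M; \<And>x. B *v (M *v x) = x; \<And>v. norm (B *v v) \<le> \<eta> * norm v\<rbrakk> \<Longrightarrow>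
      Lp_le p (\<lambda>x. f (B *v int_vec (vfloor (M *v x)))) (N + e) \<and>
      Lp_le p (\<lambda>x. f x - scale_synth M (\<lambda>k. of_real t * f (B *v int_vec k)) x) (q * N + e)"
proof -
  define V where "V = measure lebesgue (cball (0 :: real ^ 'd) (S + 2)) powr (1/p)"
  define L where "L = real (card window) * r"
  \<comment> \<open>Chosen so that all error terms of the decomposition, namely \<epsilon> V,
    \<epsilon> V q and t \<epsilon> V L, together stay below \<open>e\<close>. Here \<open>V\<close>
    is the norm of the indicator of a ball and \<open>L\<close> bounds the absolute
    periodization.\<close>
  define \<epsilon> where "\<epsilon> = e / (1 + V + V * q + t * V * L)"
  have nn: "0 \<le> V" "0 \<le> L" "0 \<le> q" "0 \<le> N"
    using r_nonneg q fN by (auto simp: V_def L_def Lp_le_def)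
  then have pos: "0 < 1 + V + V * q + t * V * L"
    using t by (simp add: add_pos_nonneg)
  then have \<epsilon>: "0 < \<epsilon>" using \<open>0 < e\<close> by (simp add: \<epsilon>_def)
  have "\<epsilon> * (1 + V + V * q + t * V * L) = e"
    using pos by (simp add: \<epsilon>_def)
  then have e: "\<epsilon> * V + (\<epsilon> * V) * q + t * (\<epsilon> * (V * L)) \<le> e" "\<epsilon> * V \<le> e"
    using \<epsilon> nn t by (auto simp: algebra_simps intro: add_increasing add_increasing2)
  obtain d where d: "0 < d" "d \<le> 1" "\<And>x y. dist x y < d \<Longrightarrow> norm (f x - f y) \<le> \<epsilon>"
    using uniformly_continuous_compact_support[OF f supp \<epsilon>] by blast
  \<comment> \<open>\<open>D\<close> exceeds the norms of all fractional parts and of all window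
    vectors, so a contraction by d/D moves sample points by less than \<open>d\<close> in both
    comparisons below.\<close>
  define D where "D = real CARD('d) + real CARD('d) * (\<lceil>R\<rceil> + 1) + 1"
  have "0 \<le> real CARD('d) * (real_of_int \<lceil>R\<rceil> + 1)"
    using order_trans[OF R le_of_int_ceiling] by simp
  moreover have "0 \<le> real CARD('d)" by simp
  ultimately have D: "1 \<le> D" "real CARD('d) < D" "real CARD('d) * (\<lceil>R\<rceil> + 1) < D"
    unfolding D_def of_int_add of_int_1 by linarith+
  define \<eta> where "\<eta> = d / D"
  have \<eta>: "0 < \<eta>" "\<eta> * D = d" using D d by (auto simp: \<eta>_def)
  show thesis
  proof (rule that[OF \<eta>(1)])
    fix M B :: "real ^ 'd ^ 'd"
    assume M: "invertible M" and BM: "\<And>x. B *v (M *v x) = x" and B: "\<And>v. norm (B *v v) \<le> \<eta> * norm v"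
    define k where "k x = vfloor (M *v x)" for x
    define g where "g k = f (B *v int_vec k)" for k
    let ?fr = "\<lambda>x. vfrac (M *v x)"
    have small: "norm (B *v v) < d" if "norm v < D" for v
    proof -
      have "norm (B *v v) \<le> \<eta> * norm v" by (rule B)
      also have "\<dots> < \<eta> * D" using that \<eta>(1) by simp
      finally show ?thesis by (simp add: \<eta>)
    qed
    have x: "dist x (B *v int_vec (k x)) < d" for x
    proof -
      have "x - B *v int_vec (k x) = B *v ?fr x"
        unfolding k_def vfrac_def by (simp add: matrix_vector_mult_diff_distrib BM)
      moreover have "norm (?fr x) < D"
        using norm_unit_cell_le[OF vfrac_in_unit_cell, of "M *v x"] D by linarith
      ultimately show ?thesis
        using small by (simp add: dist_norm)
    qed
    have kn: "dist (B *v int_vec (j)) (B *v int_vec (j - n)) < d" if "n \<in> window" for j n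
    proof -
      have "B *v int_vec j - B *v int_vec (j - n) = B *v int_vec n"
        by (simp add: matrix_vector_mult_diff_distrib[symmetric] int_vec_diff)
      then show ?thesis
        using small[of "int_vec n"] norm_window_le[OF that] D by (simp add: dist_norm)
    qed
    have near: "norm x \<le> norm y + dist x y" for x y :: "real ^ 'd"
      using norm_triangle_sub[of x y] by (simp add: dist_norm)
    let ?I = "indicat_real (cball (0 :: real ^ 'd) (S + 2))"
    have I: "Lp_le p ?I V"
      unfolding V_def by (rule Lp_le_indicator[OF p]) simp
    have IV: "Lp_le p (\<lambda>x. \<epsilon> * ?I x) (\<epsilon> * V)"
      using \<epsilon> p by (intro Lp_le_cmult[OF I]) auto
    have gm: "(\<lambda>x. g (k x)) \<in> borel_measurable lebesgue"
      unfolding k_def by (rule measurable_step[OF M])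
    have fm: "f \<in> borel_measurable lebesgue"
      using fN by (simp add: Lp_le_def)
    have fg: "Lp_le p (\<lambda>x. f x - g (k x)) (\<epsilon> * V)"
    proof (rule Lp_le_dominated[OF IV])
      have "norm (f x - g (k x)) \<le> norm (\<epsilon> * ?I x)" for x
      proof (cases "norm x \<le> S + 2")
        case True
        then show ?thesis using d(3)[OF x[of x]] \<epsilon> by (simp add: g_def)
      next
        case False
        then have "f x = 0" "g (k x) = 0"
          using supp[of x] supp[of "B *v int_vec (k x)"] near[of x "B *v int_vec (k x)"] x[of x] d(2) by (force simp: g_def)+
        then show ?thesis by simp
      qed
      then show "AE x in lebesgue. norm (f x - g (k x)) \<le> norm (\<epsilon> * ?I x)" by simp
    qed (use fm gm p in auto)
    have gk: "Lp_le p (\<lambda>x. g (k x)) (N + \<epsilon> * V)"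
      using Lp_le_diff[OF p fN fg] by simp
    \<comment> \<open>A localizing indicator that depends on \<open>x\<close> only through its cell,
      so that its product with the absolute periodization falls under the product bound; the ball
      indicator does not have this form.\<close>
    define X where "X j = (if norm (B *v int_vec j) \<le> S + 1 then 1 else 0 :: real)" for j
    have "Lp_le p (\<lambda>x. X (k x)) V"
    proof (rule Lp_le_dominated[OF I])
      have "norm (X (k x)) \<le> norm (?I x)" for x
        using near[of x "B *v int_vec (k x)"] x[of x] d(2) by (auto simp: X_def indicator_def)
      then show "AE x in lebesgue. norm (X (k x)) \<le> norm (?I x)" by simp
      show "(\<lambda>x. X (k x)) \<in> borel_measurable lebesgue"
        unfolding k_def by (rule measurable_step[OF M])
    qed (use p in auto)
    then have XP: "Lp_le p (\<lambda>x. X (k x) * abs_periodization (?fr x)) (V * L)"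
      unfolding k_def L_def
      by (intro Lp_le_step_times_periodic[OF p M] Lp_le_abs_periodization abs_periodization_measurable)
    have XP': "Lp_le p (\<lambda>x. t * (\<epsilon> * (X (k x) * abs_periodization (?fr x)))) (t * (\<epsilon> * (V * L)))"
      using \<epsilon> t p by (intro Lp_le_cmult XP) auto
    have main: "Lp_le p (\<lambda>x. g (k x) * (1 - of_real t * periodization (?fr x))) ((N + \<epsilon> * V) * q)"
      using gk q unfolding k_def
      by (intro Lp_le_step_times_periodic[OF p M, where G = "\<lambda>y. 1 - of_real t * periodization y"])
        (auto intro!: borel_measurable_diff borel_measurable_times periodization_measurable)
    \<comment> \<open>The error of replacing the coefficient at cell k - n by the one at cell k,
      which is what turns the synthesis into a sample times the periodization.\<close>
    define E where "E x = of_real t * (\<Sum>n\<in>window. (g (k x) - g (k x - n)) * \<phi> (?fr x + int_vec n))" for x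
    have E: "Lp_le p E (t * (\<epsilon> * (V * L)))"
    proof (rule Lp_le_dominated[OF XP'])
      have "norm (E x) \<le> norm (t * (\<epsilon> * (X (k x) * abs_periodization (?fr x))))" for x
      proof -
        have one: "norm (g (k x) - g (k x - n)) \<le> \<epsilon> * X (k x)" if n: "n \<in> window" for n
        proof (cases "norm (B *v int_vec (k x)) \<le> S + 1")
          case True
          then show ?thesis using d(3)[OF kn[OF n, of "k x"]] by (simp add: g_def X_def)
        next
          case False
          then have "g (k x) = 0" "g (k x - n) = 0"
            using supp[of "B *v int_vec (k x)"] supp[of "B *v int_vec (k x - n)"]
              near[of "B *v int_vec (k x)" "B *v int_vec (k x - n)"] kn[OF n, of "k x"] d(2)
            by (force simp: g_def)+
          then show ?thesis by (simp add: X_def \<epsilon> less_imp_le)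
        qed
        have "norm (\<Sum>n\<in>window. (g (k x) - g (k x - n)) * \<phi> (?fr x + int_vec n))
            \<le> (\<Sum>n\<in>window. \<epsilon> * X (k x) * norm (\<phi> (?fr x + int_vec n)))"
          by (rule sum_norm_le) (simp add: norm_mult one mult_right_mono)
        also have "\<dots> = \<epsilon> * (X (k x) * abs_periodization (?fr x))"
          by (simp add: abs_periodization_def sum_distrib_left mult.assoc)
        finally have "norm (E x) \<le> t * (\<epsilon> * (X (k x) * abs_periodization (?fr x)))"
          using t by (simp add: E_def norm_mult)
        then show ?thesis
          unfolding real_norm_def by linarith
      qed
      then show "AE x in lebesgue. norm (E x) \<le> norm (t * (\<epsilon> * (X (k x) * abs_periodization (?fr x))))" by simp
      have "(\<lambda>x. \<phi> (?fr x + int_vec n)) \<in> borel_measurable lebesgue" for n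
        using borel_measurable_matrix_affine[OF M borel_measurable_vfrac[OF meas_shift[of "int_vec n"]], of 0] by simp
      then show "E \<in> borel_measurable lebesgue"
        unfolding E_def[abs_def] k_def
        by (intro borel_measurable_times borel_measurable_const borel_measurable_sum
            measurable_step[OF M, of "\<lambda>k. g k - g (k - n)" for n])
    qed (use p in auto)
    have decomp: "f x - scale_synth M (\<lambda>k. of_real t * f (B *v int_vec k)) x =
        (f x - g (k x)) + g (k x) * (1 - of_real t * periodization (?fr x)) + E x" for x
      by (simp add: scale_synth_def E_def g_def[symmetric] k_def periodization_def algebra_simps sum_subtractf
          sum_distrib_left)
    have "Lp_le p (\<lambda>x. f x - scale_synth M (\<lambda>k. of_real t * f (B *v int_vec k)) x)
        (\<epsilon> * V + (N + \<epsilon> * V) * q + t * (\<epsilon> * (V * L)))"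
      unfolding decomp by (intro Lp_le_add[OF p] fg main E)
    then have "Lp_le p (\<lambda>x. f x - scale_synth M (\<lambda>k. of_real t * f (B *v int_vec k)) x) (q * N + e)"
      by (rule Lp_le_mono) (use e(1) p in \<open>auto simp: algebra_simps\<close>)
    moreover have "Lp_le p (\<lambda>x. f (B *v int_vec (vfloor (M *v x)))) (N + e)"
      using Lp_le_mono[OF gk, of "N + e"] e(2) p by (simp add: g_def k_def)
    ultimately show "Lp_le p (\<lambda>x. f (B *v int_vec (vfloor (M *v x)))) (N + e) \<and>
      Lp_le p (\<lambda>x. f x - scale_synth M (\<lambda>k. of_real t * f (B *v int_vec k)) x) (q * N + e)" by blast
  qed
qed

end

subsection \<open>Affine systems\<close>

text \<open>Completeness of Lebesgue measure carries measurability over to \<open>h\<close>.\<close>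

lemma Lp_le_cong_AE:
  fixes g h :: "real ^ 'd \<Rightarrow> complex"
  assumes "Lp_le p g r" "AE x in lebesgue. h x = g x"
  shows "Lp_le p h r"
proof -
  have "AE x in lebesgue. g x = h x"
    using assms(2) by eventually_elim simp
  then have "h \<in> borel_measurable lebesgue"
    using borel_measurable_AE[OF Lp_le_measurable[OF assms(1)]] by simp
  moreover have "(\<integral>\<^sup>+x. ennreal (norm (h x) powr p) \<partial>lebesgue) = (\<integral>\<^sup>+x. ennreal (norm (g x) powr p) \<partial>lebesgue)"
    using assms(2) by (intro nn_integral_cong_AE) auto
  ultimately show ?thesis
    using assms(1) by (simp add: Lp_le_def)
qed

lemma Lp_le_matrix:
  fixes A :: "real ^ 'd ^ 'd" and g :: "real ^ 'd \<Rightarrow> 'b::real_normed_vector"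
  assumes p: "1 \<le> p" and A: "invertible A" and g: "Lp_le p g r"
  shows "Lp_le p (\<lambda>x. g (A *v x)) (\<bar>det A\<bar> powr (-1/p) * r)"
proof -
  have D: "\<bar>det A\<bar> > 0" using A by (simp add: invertible_det_nz)
  have m: "g \<in> borel_measurable lebesgue" and r: "0 \<le> r" using g by (simp_all add: Lp_le_def)
  then have "(\<lambda>x. ennreal (norm (g x) powr p)) \<in> borel_measurable lebesgue"
    by measurable
  from nn_integral_matrix_affine[OF A this, of 0]
  have "ennreal \<bar>det A\<bar> * (\<integral>\<^sup>+x. ennreal (norm (g (A *v x)) powr p) \<partial>lebesgue) \<le> ennreal (r powr p)"
    using g by (simp add: Lp_le_def)
  then have "ennreal (inverse \<bar>det A\<bar>) * (ennreal \<bar>det A\<bar> * (\<integral>\<^sup>+x. ennreal (norm (g (A *v x)) powr p) \<partial>lebesgue))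
      \<le> ennreal (inverse \<bar>det A\<bar>) * ennreal (r powr p)"
    by (intro mult_left_mono) auto
  also have "ennreal (inverse \<bar>det A\<bar>) * (ennreal \<bar>det A\<bar> * (\<integral>\<^sup>+x. ennreal (norm (g (A *v x)) powr p) \<partial>lebesgue))
      = (\<integral>\<^sup>+x. ennreal (norm (g (A *v x)) powr p) \<partial>lebesgue)"
    using D by (simp add: mult.assoc[symmetric] ennreal_mult[symmetric])
  also have "ennreal (inverse \<bar>det A\<bar>) * ennreal (r powr p) = ennreal ((\<bar>det A\<bar> powr (-1/p) * r) powr p)"
  proof -
    have "(\<bar>det A\<bar> powr (-1/p)) powr p = inverse \<bar>det A\<bar>"
      unfolding powr_powr using p D by (simp add: powr_minus)
    then show ?thesis
      by (simp add: powr_mult ennreal_mult)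
  qed
  finally show ?thesis
    using r borel_measurable_matrix_affine[OF A m, of 0] by (simp add: Lp_le_def)
qed

text \<open>The complement of the support may be an uncountable union of open sets; a countable
  subfamily with the same union exists by Lindelof, and countably many null sets are
  harmless.\<close>

lemma AE_zero_outside_spt:
  fixes f :: "real ^ 'd \<Rightarrow> complex"
  shows "AE x in lebesgue. x \<notin> spt f \<longrightarrow> f x = 0"
proof -
  let ?F = "{U. open U \<and> (AE x in lebesgue. x \<in> U \<longrightarrow> f x = 0)}"
  obtain F' where F': "F' \<subseteq> ?F" "countable F'" "\<Union>F' = \<Union>?F"
    using Lindelof[of ?F] by auto
  have "AE x in lebesgue. \<forall>U\<in>F'. x \<in> U \<longrightarrow> f x = 0"
    using F' by (subst AE_ball_countable) auto
  then show ?thesis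
    by eventually_elim (use F'(3) in \<open>auto simp: spt_def\<close>)
qed

lemma spt_affine_subset:
  fixes A :: "real ^ 'd ^ 'd" and f :: "real ^ 'd \<Rightarrow> complex"
  assumes A: "invertible A"
  shows "spt (\<lambda>x. c * f (A *v x - v)) \<subseteq> {x. A *v x - v \<in> spt f}"
proof -
  have "x \<notin> spt (\<lambda>x. c * f (A *v x - v))" if "A *v x - v \<notin> spt f" for x
  proof -
    obtain U where U: "open U" "AE x in lebesgue. x \<in> U \<longrightarrow> f x = 0" "A *v x - v \<in> U"
      using \<open>A *v x - v \<notin> spt f\<close> by (auto simp: spt_def)
    have "open ((\<lambda>x. A *v x - v) -` U)"
      by (intro open_vimage U continuous_intros)
    moreover have "AE x in lebesgue. x \<in> (\<lambda>x. A *v x - v) -` U \<longrightarrow> c * f (A *v x - v) = 0"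
      using AE_matrix_affine[OF A U(2), of "-v"] by eventually_elim simp
    moreover have "x \<in> (\<lambda>x. A *v x - v) -` U"
      using U(3) by simp
    ultimately show ?thesis
      unfolding spt_def by blast
  qed
  then show ?thesis by blast
qed

lemma summable_on_of_nn_integral:
  fixes f :: "'a \<Rightarrow> real"
  assumes "\<And>x. 0 \<le> f x" "(\<integral>\<^sup>+x. ennreal (f x) \<partial>count_space UNIV) \<le> ennreal Y" "0 \<le> Y"
  shows "f summable_on UNIV" "(\<Sum>\<^sub>\<infinity>x. f x) \<le> Y"
proof -
  have "(\<integral>\<^sup>+x. ennreal (f x) \<partial>count_space UNIV) < \<infinity>"
    using assms(2) by (auto intro: le_less_trans)
  then have "integrable (count_space UNIV) f"
    using assms(1) by (intro integrableI_nonneg) auto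
  then have "Infinite_Set_Sum.abs_summable_on f UNIV"
    by (simp add: Infinite_Set_Sum.abs_summable_on_def)
  then show s: "f summable_on UNIV"
    using assms(1) by (simp flip: abs_summable_equivalent)
  show "(\<Sum>\<^sub>\<infinity>x. f x) \<le> Y"
    using assms nn_integral_count_space_eq_infsum[OF s assms(1)] by (simp add: ennreal_le_iff)
qed

lemma norm_matrix_bound: "norm (A *v x) \<le> onorm ((*v) A) * norm x"
  for A :: "real ^ 'd ^ 'd"
  by (rule onorm) (rule matrix_vector_mul_bounded_linear)

lemma onorm_matrix_nonneg: "0 \<le> onorm ((*v) (A :: real ^ 'd ^ 'd))"
  by (rule onorm_pos_le) (rule matrix_vector_mul_bounded_linear)

lemma invertible_matrix_inv: "invertible A \<Longrightarrow> invertible (matrix_inv A)"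
  for A :: "real ^ 'd ^ 'd"
  using matrix_inv_mult[of A] by (auto simp: invertible_def)

section \<open>The affine system in lattice coordinates\<close>

locale affine_system =
  fixes a :: "nat \<Rightarrow> real ^ 'd ^ 'd" and b :: "real ^ 'd ^ 'd"
    and \<Omega> :: "(real ^ 'd) set" and \<psi> :: "real ^ 'd \<Rightarrow> complex" and p :: real
  assumes inv_a: "\<And>j. j \<ge> 1 \<Longrightarrow> invertible (a j)"
    and expanding: "(\<lambda>j. onorm (\<lambda>x. matrix_inv (a j) *v x)) \<longlonglongrightarrow> 0"
    and inv_b: "invertible b"
    and open_\<Omega>: "open \<Omega>"
    and p: "1 \<le> p"
    and \<psi>_Lp: "\<psi> \<in> Lp p UNIV" and \<psi>_compact: "compact (spt \<psi>)"
    and \<psi>_mean: "(LINT x|lebesgue. \<psi> x) = 1"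
begin

definition "M j = matrix_inv b ** a j"
text \<open>The inverse of \<open>M j\<close> for j \<ge> 1; it sends integer vectors to sample
  points.\<close>

definition "B j = matrix_inv (a j) ** b"
text \<open>The scalar with \<psi>_{j,k}(x) = weight j * \<phi>(M_j x - k) almost everywhere; the
  division undoes the factor that gives \<open>\<phi>\<close> mean one.\<close>

definition "weight j = \<bar>det (a j)\<bar> powr (1 / p) / \<bar>det b\<bar>"

definition "\<rho> = (SOME R. 0 \<le> R \<and> spt \<psi> \<subseteq> cball 0 R)"

text \<open>The prototype in lattice coordinates, made to vanish everywhere outside a ball.\<close>

definition "\<phi> y = (if norm (b *v y) \<le> \<rho> then of_real \<bar>det b\<bar> * \<psi> (b *v y) else 0)"

lemma \<rho>: "0 \<le> \<rho>" "spt \<psi> \<subseteq> cball 0 \<rho>"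
proof -
  obtain e where "0 < e" "\<forall>x\<in>spt \<psi>. norm x \<le> e"
    using compact_imp_bounded[OF \<psi>_compact] unfolding bounded_pos by blast
  then have "0 \<le> e \<and> spt \<psi> \<subseteq> cball 0 e" by auto
  then have "0 \<le> \<rho> \<and> spt \<psi> \<subseteq> cball 0 \<rho>"
    unfolding \<rho>_def by (rule someI)
  then show "0 \<le> \<rho>" "spt \<psi> \<subseteq> cball 0 \<rho>"
    by blast+
qed

lemma det_b: "\<bar>det b\<bar> > 0"
  using inv_b by (simp add: invertible_det_nz)

lemma det_a: "j \<ge> 1 \<Longrightarrow> \<bar>det (a j)\<bar> > 0"
  using inv_a by (simp add: invertible_det_nz)

lemma weight_pos: "j \<ge> 1 \<Longrightarrow> weight j > 0"
  using det_a det_b by (simp add: weight_def)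

lemma invertible_M: "j \<ge> 1 \<Longrightarrow> invertible (M j)"
  unfolding M_def using inv_a inv_b by (intro invertible_mult invertible_matrix_inv)

lemma det_M: "\<bar>det (M j)\<bar> = \<bar>det (a j)\<bar> / \<bar>det b\<bar>"
  using abs_det_matrix_inv[OF inv_b] det_b by (simp add: M_def det_mul abs_mult field_simps)

lemma BM: "j \<ge> 1 \<Longrightarrow> B j *v (M j *v x) = x"
  by (simp add: B_def M_def matrix_vector_mul_assoc[symmetric] matrix_inv_cancel inv_a inv_b)

lemma bM: "b *v (M j *v x) = a j *v x"
  by (simp add: M_def matrix_vector_mul_assoc[symmetric] matrix_inv_cancel inv_b)

text \<open>The bound on the inverse dilation shrinks the supports of the affine functions, the
  bound on \<open>B j\<close> the mesh of the sample points. Since K \<ge> 1, the single estimate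
  \<eta>/K yields both.\<close>

lemma eventually_contracting:
  assumes "0 < \<eta>"
  shows "\<forall>\<^sub>F j in sequentially. (\<forall>v. norm (matrix_inv (a j) *v v) \<le> \<eta> * norm v) \<and> (\<forall>v. norm (B j *v v) \<le> \<eta> * norm v)"
proof -
  define K where "K = onorm ((*v) b) + 1"
  have K: "1 \<le> K" "norm (b *v v) \<le> K * norm v" for v
    using onorm_matrix_nonneg[of b] norm_matrix_bound[of b v] by (auto simp: K_def distrib_right add_increasing2)
  have "0 < \<eta> / K" using assms K(1) by simp
  then have "\<forall>\<^sub>F j in sequentially. onorm ((*v) (matrix_inv (a j))) < \<eta> / K"
    using order_tendstoD(2)[OF expanding] by simp
  then show ?thesis
  proof eventually_elim
    case (elim j)
    have 1: "norm (matrix_inv (a j) *v v) \<le> \<eta> / K * norm v" for v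
      using norm_matrix_bound[of "matrix_inv (a j)" v] elim mult_right_mono[of _ _ "norm v"]
      by (meson less_imp_le norm_ge_zero order_trans)
    have "\<eta> / K \<le> \<eta>" using assms K(1) by (simp add: divide_le_eq)
    then have "norm (matrix_inv (a j) *v v) \<le> \<eta> * norm v" for v
      using 1[of v] mult_right_mono[of "\<eta> / K" \<eta> "norm v"] by simp
    moreover have "norm (B j *v v) \<le> \<eta> * norm v" for v
    proof -
      have "norm (B j *v v) \<le> \<eta> / K * norm (b *v v)"
        using 1[of "b *v v"] by (simp add: B_def matrix_vector_mul_assoc)
      also have "\<dots> \<le> \<eta> / K * (K * norm v)"
        using K assms by (intro mult_left_mono) auto
      finally show ?thesis using K(1) by simp
    qed
    ultimately show ?case by simp
  qed
qed

lemma \<phi>_AE: "AE y in lebesgue. \<phi> y = of_real \<bar>det b\<bar> * \<psi> (b *v y)"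
proof -
  have "AE x in lebesgue. b *v x + 0 \<notin> spt \<psi> \<longrightarrow> \<psi> (b *v x + 0) = 0"
    by (rule AE_matrix_affine[OF inv_b AE_zero_outside_spt])
  then show ?thesis
    by eventually_elim (use \<rho>(2) in \<open>auto simp: \<phi>_def\<close>)
qed

lemma \<phi>_Lp: "Lp_le p \<phi> (\<bar>det b\<bar> * (\<bar>det b\<bar> powr (-1/p) * Lp_norm p UNIV \<psi>))"
proof -
  have "Lp_le p (\<lambda>y. of_real \<bar>det b\<bar> * \<psi> (b *v y)) (\<bar>det b\<bar> * (\<bar>det b\<bar> powr (-1/p) * Lp_norm p UNIV \<psi>))"
    using p by (intro Lp_le_cmult Lp_le_matrix inv_b Lp_normD \<psi>_Lp) auto
  then show ?thesis
    using Lp_le_cong_AE[OF _ \<phi>_AE] by blast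
qed

lemma \<phi>_mean: "(LINT y|lebesgue. \<phi> y) = 1"
proof -
  have m: "\<psi> \<in> borel_measurable lebesgue" using \<psi>_Lp by (simp add: Lp_def)
  have m': "(\<lambda>y. of_real \<bar>det b\<bar> * \<psi> (b *v y)) \<in> borel_measurable lebesgue"
    using borel_measurable_matrix_affine[OF inv_b m, of 0] by (intro borel_measurable_times) auto
  have "(LINT y|lebesgue. \<phi> y) = (LINT y|lebesgue. of_real \<bar>det b\<bar> * \<psi> (b *v y))"
    using \<phi>_AE \<phi>_Lp m' by (intro integral_cong_AE) (auto simp: Lp_le_def)
  also have "\<dots> = (LINT x|lebesgue. \<psi> x)"
    using integral_matrix_affine[OF inv_b m, of 0] by (simp add: scaleR_conv_of_real)
  finally show ?thesis by (simp add: \<psi>_mean)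
qed

definition "r = \<bar>det b\<bar> * (\<bar>det b\<bar> powr (-1/p) * Lp_norm p UNIV \<psi>)"

sublocale bump p \<phi> r "onorm ((*v) (matrix_inv b)) * \<rho>"
proof
  show "0 \<le> onorm ((*v) (matrix_inv b)) * \<rho>"
    using \<rho>(1) onorm_matrix_nonneg[of "matrix_inv b"] by simp
  fix y assume "\<phi> y \<noteq> 0"
  then have "norm (b *v y) \<le> \<rho>" by (auto simp: \<phi>_def split: if_splits)
  then have "onorm ((*v) (matrix_inv b)) * norm (b *v y) \<le> onorm ((*v) (matrix_inv b)) * \<rho>"
    using onorm_matrix_nonneg[of "matrix_inv b"] by (intro mult_left_mono) auto
  then show "norm y \<le> onorm ((*v) (matrix_inv b)) * \<rho>"
    using norm_matrix_bound[of "matrix_inv b" "b *v y"] by (simp add: matrix_inv_cancel inv_b)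
qed (use p \<phi>_Lp \<phi>_mean in \<open>auto simp: r_def\<close>)

text \<open>The lattice is countable, so one null set serves all \<open>k\<close>, as the sum over
  \<open>k\<close> requires.\<close>

lemma affine_fun_AE:
  assumes "j \<ge> 1"
  shows "AE x in lebesgue. \<forall>k. affine_fun a b p \<psi> j k x = of_real (weight j) * \<phi> (M j *v x - int_vec k)"
proof -
  have "AE x in lebesgue. affine_fun a b p \<psi> j k x = of_real (weight j) * \<phi> (M j *v x - int_vec k)" for k
    using AE_matrix_affine[OF invertible_M[OF assms] \<phi>_AE, of "- int_vec k"]
  proof eventually_elim
    case (elim x)
    then have "\<phi> (M j *v x - int_vec k) = of_real \<bar>det b\<bar> * \<psi> (a j *v x - b *v int_vec k)"
      by (simp add: matrix_vector_mult_diff_distrib bM)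
    then show ?case
      using det_b by (simp add: affine_fun_def weight_def)
  qed
  then show ?thesis
    by (simp add: AE_all_countable)
qed

lemma scale_sum_AE:
  assumes "j \<ge> 1"
  shows "AE x in lebesgue. (\<lambda>k. norm (c j k * affine_fun a b p \<psi> j k x)) summable_on UNIV \<and>
    scale_sum a b p \<psi> c j x = scale_synth (M j) (\<lambda>k. c j k * of_real (weight j)) x"
  using affine_fun_AE[OF assms]
proof eventually_elim
  case (elim x)
  have eq: "c j k * affine_fun a b p \<psi> j k x = c j k * of_real (weight j) * \<phi> (M j *v x - int_vec k)" for k
    using elim by (simp add: mult.assoc)
  show ?case
    unfolding scale_sum_def eq using translates_sum[of "\<lambda>k. c j k * of_real (weight j)" "M j" x] by blast
qed

text \<open>The last factor is what remains of |det M_j|^(-1/p) times \<open>weight j\<close> after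
  det a_j cancels; hence the constant is the same at every scale.\<close>

definition "synth_const = real (card window) * r * (\<bar>det b\<bar> powr (1/p) / \<bar>det b\<bar>)"

lemma synth_const_nonneg: "0 \<le> synth_const"
  using r_nonneg by (simp add: synth_const_def)

lemma Lp_le_scale_sum:
  assumes j: "j \<ge> 1" and c: "(\<lambda>k. norm (c j k) powr p) summable_on UNIV"
  shows "Lp_le p (scale_sum a b p \<psi> c j) (synth_const * (\<Sum>\<^sub>\<infinity>k. norm (c j k) powr p) powr (1/p))"
proof -
  let ?w = "weight j" and ?C = "\<Sum>\<^sub>\<infinity>k. norm (c j k) powr p"
  have eq: "norm (c j k * of_real ?w) powr p = ?w powr p * norm (c j k) powr p" for k
    using weight_pos[OF j] by (simp add: norm_mult powr_mult mult.commute)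
  have s: "(\<lambda>k. norm (c j k * of_real ?w) powr p) summable_on UNIV"
    unfolding eq by (rule summable_on_cmult_right[OF c])
  have "(\<Sum>\<^sub>\<infinity>k. norm (c j k * of_real ?w) powr p) = ?w powr p * ?C"
    unfolding eq by (rule infsum_cmult_right')
  then have "(\<Sum>\<^sub>\<infinity>k. norm (c j k * of_real ?w) powr p) powr (1/p) = ?w * ?C powr (1/p)"
    using p weight_pos[OF j] by (simp add: powr_mult powr_powr)
  moreover have "\<bar>det (M j)\<bar> powr (-1/p) * ?w = \<bar>det b\<bar> powr (1/p) / \<bar>det b\<bar>"
    using det_a[OF j] det_b by (simp add: det_M weight_def powr_divide powr_minus field_simps)
  ultimately have "real (card window) * r * (\<bar>det (M j)\<bar> powr (-1/p) * (\<Sum>\<^sub>\<infinity>k. norm (c j k * of_real ?w) powr p) powr (1/p))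
      = synth_const * ?C powr (1/p)"
    by (simp add: synth_const_def mult.assoc[symmetric])
  with Lp_le_scale_synth[OF invertible_M[OF j] s]
  have "Lp_le p (scale_synth (M j) (\<lambda>k. c j k * of_real ?w)) (synth_const * ?C powr (1/p))"
    by simp
  moreover have "AE x in lebesgue. scale_sum a b p \<psi> c j x = scale_synth (M j) (\<lambda>k. c j k * of_real ?w) x"
    using scale_sum_AE[OF j, of c] by eventually_elim simp
  ultimately show ?thesis
    by (rule Lp_le_cong_AE)
qed

lemma scale_sum_zero_outside:
  assumes "\<And>k. c j k \<noteq> 0 \<Longrightarrow> spt (affine_fun a b p \<psi> j k) \<subseteq> \<Omega>"
  shows "AE x in lebesgue. x \<notin> \<Omega> \<longrightarrow> scale_sum a b p \<psi> c j x = 0"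
proof -
  have "AE x in lebesgue. \<forall>k. x \<notin> spt (affine_fun a b p \<psi> j k) \<longrightarrow> affine_fun a b p \<psi> j k x = 0"
    by (simp add: AE_all_countable AE_zero_outside_spt)
  then show ?thesis
  proof eventually_elim
    case (elim x)
    have "scale_sum a b p \<psi> c j x = 0" if "x \<notin> \<Omega>"
    proof -
      have "c j k * affine_fun a b p \<psi> j k x = 0" for k
        using elim that assms[of k] by (cases "c j k = 0") auto
      then show ?thesis
        by (simp only: scale_sum_def infsum_0_simp)
    qed
    then show ?case by blast
  qed
qed

section \<open>The lower estimate\<close>

theorem synthesis_bound:
  assumes c: "c \<in> l1lp p" and f: "is_synthesis a b p \<psi> c f"
  shows "Lp_norm p UNIV f \<le> synth_const * l1lp_norm p c"
proof -
  let ?S = "scale_sum a b p \<psi> c" and ?n = "\<lambda>j. (\<Sum>\<^sub>\<infinity>k. norm (c j k) powr p) powr (1/p)"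
  have cs: "\<And>j. j \<ge> 1 \<Longrightarrow> (\<lambda>k. norm (c j k) powr p) summable_on UNIV" and n: "?n summable_on {1..}"
    using c by (auto simp: l1lp_def)
  have "Lp_norm p UNIV f \<le> Lp_norm p UNIV (\<lambda>x. f x - (\<Sum>j=1..J. ?S j x)) + synth_const * l1lp_norm p c" for J
  proof -
    have P: "Lp_le p (\<lambda>x. \<Sum>j=1..J. ?S j x) (\<Sum>j=1..J. synth_const * ?n j)"
      by (intro Lp_le_sum[OF p] Lp_le_scale_sum cs) auto
    \<comment> \<open>This crude bound only places the remainder in L^p; its own norm is then a
      legitimate bound, and that norm tends to zero with \<open>J\<close>.\<close>
    have "Lp_le p (\<lambda>x. f x - (\<Sum>j=1..J. ?S j x)) (Lp_norm p UNIV f + (\<Sum>j=1..J. synth_const * ?n j))"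
      using f by (intro Lp_le_diff[OF p] P Lp_normD p) (simp add: is_synthesis_def)
    then have "Lp_le p (\<lambda>x. f x - (\<Sum>j=1..J. ?S j x)) (Lp_norm p UNIV (\<lambda>x. f x - (\<Sum>j=1..J. ?S j x)))"
      by (intro Lp_normD p) (simp add: Lp_le_iff[OF p])
    from Lp_le_add[OF p this P]
    have "Lp_norm p UNIV f \<le> Lp_norm p UNIV (\<lambda>x. f x - (\<Sum>j=1..J. ?S j x)) + (\<Sum>j=1..J. synth_const * ?n j)"
      by (simp add: Lp_le_iff[OF p])
    moreover have "(\<Sum>j=1..J. ?n j) \<le> l1lp_norm p c"
      unfolding l1lp_norm_def by (rule finite_sum_le_infsum[OF n]) auto
    then have "(\<Sum>j=1..J. synth_const * ?n j) \<le> synth_const * l1lp_norm p c"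
      using synth_const_nonneg by (simp add: sum_distrib_left[symmetric] mult_left_mono)
    ultimately show ?thesis by simp
  qed
  moreover have "(\<lambda>J. Lp_norm p UNIV (\<lambda>x. f x - (\<Sum>j=1..J. ?S j x)) + synth_const * l1lp_norm p c) \<longlonglongrightarrow> 0 + synth_const * l1lp_norm p c"
    using f by (intro tendsto_add tendsto_const) (simp add: is_synthesis_def)
  ultimately show ?thesis
    using LIMSEQ_le_const[of _ "0 + synth_const * l1lp_norm p c" "Lp_norm p UNIV f"] by auto
qed

end

section \<open>Contraction at a single scale\<close>

lemma summable_lp_of_scaled_step:
  fixes M :: "real ^ 'd ^ 'd" and g :: "int ^ 'd \<Rightarrow> complex"
  assumes p: "1 \<le> p" and M: "invertible M" and g: "Lp_le p (\<lambda>x. g (vfloor (M *v x))) N"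
  shows "(\<lambda>k. norm (g k) powr p) summable_on UNIV"
    "(\<Sum>\<^sub>\<infinity>k. norm (g k) powr p) powr (1/p) \<le> \<bar>det M\<bar> powr (1/p) * N"
proof -
  have N: "0 \<le> N" using g by (simp add: Lp_le_def)
  \<comment> \<open>The step identity read backwards: the coefficient norm is recovered from the
    norm of the step function.\<close>
  have "(\<integral>\<^sup>+k. ennreal (norm (g k) powr p) \<partial>count_space UNIV) \<le> ennreal \<bar>det M\<bar> * ennreal (N powr p)"
    unfolding nn_integral_step[OF M, symmetric] using g by (intro mult_left_mono) (auto simp: Lp_le_def)
  then have le: "(\<integral>\<^sup>+k. ennreal (norm (g k) powr p) \<partial>count_space UNIV) \<le> ennreal (\<bar>det M\<bar> * N powr p)"
    by (simp add: ennreal_mult)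
  show "(\<lambda>k. norm (g k) powr p) summable_on UNIV"
    by (rule summable_on_of_nn_integral(1)[OF _ le]) auto
  have "(\<Sum>\<^sub>\<infinity>k. norm (g k) powr p) \<le> \<bar>det M\<bar> * N powr p"
    by (rule summable_on_of_nn_integral(2)[OF _ le]) auto
  then have "(\<Sum>\<^sub>\<infinity>k. norm (g k) powr p) powr (1/p) \<le> (\<bar>det M\<bar> * N powr p) powr (1/p)"
    using p by (intro powr_mono2 infsum_nonneg) auto
  also have "\<dots> = \<bar>det M\<bar> powr (1/p) * N"
    using p N by (simp add: powr_mult powr_powr)
  finally show "(\<Sum>\<^sub>\<infinity>k. norm (g k) powr p) powr (1/p) \<le> \<bar>det M\<bar> powr (1/p) * N" .
qed

context affine_system
begin

text \<open>Both bounds are relative to the norm of the current \<open>f\<close>, which makes the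
  step iterable. The row \<open>c\<close> is passed as a sequence constant in the scale because
  \<open>scale_sum\<close> reads only row \<open>j\<close>.\<close>

definition good_scale :: "real \<Rightarrow> real \<Rightarrow> (real ^ 'd \<Rightarrow> complex) \<Rightarrow> nat \<Rightarrow> (int ^ 'd \<Rightarrow> complex) \<Rightarrow> bool" where
  "good_scale L K f j c \<longleftrightarrow> 1 \<le> j \<and> (\<lambda>k. norm (c k) powr p) summable_on UNIV \<and>
     (\<Sum>\<^sub>\<infinity>k. norm (c k) powr p) powr (1/p) \<le> K * Lp_norm p UNIV f \<and>
     (\<forall>k. c k \<noteq> 0 \<longrightarrow> spt (affine_fun a b p \<psi> j k) \<subseteq> \<Omega>) \<and>
     Lp_le p (\<lambda>x. f x - scale_sum a b p \<psi> (\<lambda>_. c) j x) (L * Lp_norm p UNIV f)"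

text \<open>Treated apart because a zero norm leaves no room for a positive approximation
  error.\<close>

lemma good_scale_zero:
  assumes f: "f \<in> Lp p UNIV" and "Lp_norm p UNIV f = 0" and j: "1 \<le> j"
  shows "good_scale L K f j (\<lambda>_. 0)"
proof -
  have "scale_sum a b p \<psi> (\<lambda>_ _. 0) j x = 0" for x
    by (simp add: scale_sum_def)
  then show ?thesis
    using Lp_normD[OF p f] assms p by (simp add: good_scale_def)
qed

lemma spt_affine_fun_subset:
  assumes j: "1 \<le> j" and \<eta>: "\<And>v. norm (matrix_inv (a j) *v v) \<le> \<eta> * norm v" "0 \<le> \<eta>"
  shows "spt (affine_fun a b p \<psi> j k) \<subseteq> cball (B j *v int_vec k) (\<eta> * \<rho>)"
proof
  fix x assume "x \<in> spt (affine_fun a b p \<psi> j k)"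
  then have "a j *v x - b *v int_vec k \<in> spt \<psi>"
    using spt_affine_subset[OF inv_a[OF j], of "complex_of_real (\<bar>det (a j)\<bar> powr (1 / p))" \<psi> "b *v int_vec k"]
    by (auto simp: affine_fun_def[abs_def])
  then have n: "norm (a j *v x - b *v int_vec k) \<le> \<rho>"
    using \<rho>(2) by auto
  have "x - B j *v int_vec k = matrix_inv (a j) *v (a j *v x - b *v int_vec k)"
    by (simp add: matrix_vector_mult_diff_distrib matrix_inv_mult(2)[OF inv_a[OF j]] B_def matrix_vector_mul_assoc)
  then have "norm (x - B j *v int_vec k) \<le> \<eta> * norm (a j *v x - b *v int_vec k)"
    using \<eta>(1) by simp
  also have "\<dots> \<le> \<eta> * \<rho>"
    using n \<eta>(2) by (rule mult_left_mono)
  finally show "x \<in> cball (B j *v int_vec k) (\<eta> * \<rho>)"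
    by (simp add: dist_norm norm_minus_commute)
qed

text \<open>\<open>L\<close> and \<open>K\<close> are fixed before the function; only how large the
  scale must be depends on it. The scale can exceed any \<open>J\<close> because the matrix
  contractions hold eventually.\<close>

proposition one_scale_contraction:
  obtains L K where "0 \<le> L" "L < 1" "0 < K"
    "\<And>f J. f \<in> Lp p \<Omega> \<Longrightarrow> \<exists>j c. J < j \<and> good_scale L K f j c"
proof -
  obtain t q where t: "0 < t" and q: "0 \<le> q" "q < 1"
    and tq: "Lp_le p (\<lambda>y. indicator unit_cell y *\<^sub>R (1 - of_real t * periodization y)) q"
    using unit_cell_small_step_contracts[OF p Lp_le_periodization periodization_measurable mean_periodization] by blast
  \<comment> \<open>Midway between \<open>q\<close> and 1: the gap (1-q)/2 pays for the
    approximation and sampling errors.\<close>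
  define L where "L = (1 + q) / 2"
  define K where "K = 2 * t * (\<bar>det b\<bar> * \<bar>det b\<bar> powr (-1/p))"
  have LK: "0 \<le> L" "L < 1" "0 < K"
    using q t det_b by (auto simp: L_def K_def)
  show thesis
  proof (rule that[OF LK])
    fix f J assume f: "f \<in> Lp p \<Omega>"
    then have fU: "f \<in> Lp p UNIV" by (simp add: Lp_def)
    define N where "N = Lp_norm p UNIV f"
    show "\<exists>j c. J < j \<and> good_scale L K f j c"
    proof (cases "N = 0")
      case True
      then show ?thesis
        using good_scale_zero[OF fU, of "Suc J"] unfolding N_def by (intro exI[of _ "Suc J"]) auto
    next
      case False
      then have N: "0 < N" using Lp_norm_nonneg[of p UNIV f] by (simp add: N_def)
      \<comment> \<open>The errors add up to at most 3e, which is exactly that gap times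
        \<open>N\<close>. Moreover N + 2e \<le> 2N, whence the factor 2 in \<open>K\<close>.\<close>
      define e where "e = (1 - q) * N / 6"
      have e: "0 < e" "3 * e = (1 - q) * N / 2" "2 * e \<le> N"
      proof -
        show "0 < e" "3 * e = (1 - q) * N / 2"
          using q N by (simp_all add: e_def)
        have "(1 - q) * N \<le> 1 * N"
          using q N by (intro mult_right_mono) auto
        then show "2 * e \<le> N"
          using N unfolding e_def by linarith
      qed
      obtain g C where g: "continuous_on UNIV g" "compact C" "C \<subseteq> \<Omega>" "\<And>x. x \<notin> C \<Longrightarrow> g x = 0"
        "Lp_le p (\<lambda>x. f x - g x) e"
        using Lp_approx_continuous_compact_support[OF p open_\<Omega> f e(1)] by metis
      have gN: "Lp_le p g (N + e)"
        using Lp_le_diff[OF p Lp_normD[OF p fU] g(5)] by (simp add: N_def)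
      obtain S where S: "\<forall>x\<in>C. norm x \<le> S"
        using compact_imp_bounded[OF g(2)] unfolding bounded_pos by blast
      have gS: "norm x \<le> S" if "g x \<noteq> 0" for x
        using g(4)[of x] S that by blast
      obtain \<eta> where \<eta>: "0 < \<eta>" and samp: "\<And>M B :: real ^ 'd ^ 'd.
          \<lbrakk>invertible M; \<And>x. B *v (M *v x) = x; \<And>v. norm (B *v v) \<le> \<eta> * norm v\<rbrakk> \<Longrightarrow>
          Lp_le p (\<lambda>x. g (B *v int_vec (vfloor (M *v x)))) (N + e + e) \<and>
          Lp_le p (\<lambda>x. g x - scale_synth M (\<lambda>k. of_real t * g (B *v int_vec k)) x) (q * (N + e) + e)"
        using sampling_approximation[OF g(1) gS gN t tq e(1)] by blast
      obtain d where d: "0 < d" "(\<Union>x\<in>C. cball x d) \<subseteq> \<Omega>"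
        using compact_subset_open_imp_cball_epsilon_subset[OF g(2) open_\<Omega> g(3)] by blast
      \<comment> \<open>Besides sampling accuracy, the support radius \<eta>' \<rho> must stay below
        the distance \<open>d\<close> available around \<open>C\<close>; adding 1 to \<rho> avoids
        dividing by zero.\<close>
      define \<eta>' where "\<eta>' = min \<eta> (d / (\<rho> + 1))"
      have \<eta>': "0 < \<eta>'" "\<eta>' \<le> \<eta>" using \<eta> d \<rho> by (auto simp: \<eta>'_def)
      have "\<eta>' * \<rho> \<le> d / (\<rho> + 1) * (\<rho> + 1)"
        using \<rho>(1) \<eta>'(1) d by (intro mult_mono) (auto simp: \<eta>'_def)
      then have \<eta>'d: "\<eta>' * \<rho> \<le> d" using \<rho>(1) by simp
      obtain j where j: "Suc J \<le> j" and contr: "\<And>v. norm (matrix_inv (a j) *v v) \<le> \<eta>' * norm v"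
        "\<And>v. norm (B j *v v) \<le> \<eta>' * norm v"
        using eventually_contracting[OF \<eta>'(1)] eventually_ge_at_top[of "Suc J"]
        by (metis (mono_tags, lifting) eventually_conj eventually_happens sequentially_bot)
      have j1: "1 \<le> j" using j by simp
      have Bj: "norm (B j *v v) \<le> \<eta> * norm v" for v
        using contr(2)[of v] mult_right_mono[OF \<eta>'(2), of "norm v"] by simp
      note s = samp[OF invertible_M[OF j1] BM[OF j1] Bj]
      \<comment> \<open>Dividing by the weight makes the synthesis at scale \<open>j\<close> the one
        built from t times the samples. It is also adapted: a nonzero coefficient forces its sample
        point into \<open>C\<close>.\<close>
      define c where "c k = of_real (t / weight j) * g (B j *v int_vec k)" for k
      have w: "0 < weight j" using weight_pos[OF j1] .
      have "Lp_le p (\<lambda>x. c (vfloor (M j *v x))) (t / weight j * (N + e + e))"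
        unfolding c_def using s t w p by (intro Lp_le_cmult) (auto simp: norm_divide)
      note cs = summable_lp_of_scaled_step[OF p invertible_M[OF j1] this]
      \<comment> \<open>The determinant of \<open>a j\<close> cancels, so the coefficient bound does
        not grow with the scale.\<close>
      have "\<bar>det (M j)\<bar> powr (1/p) * (t / weight j * (N + e + e)) = t * (\<bar>det b\<bar> * \<bar>det b\<bar> powr (-1/p)) * (N + e + e)"
        using det_a[OF j1] det_b by (simp add: det_M weight_def powr_divide powr_minus field_simps)
      also have "\<dots> \<le> t * (\<bar>det b\<bar> * \<bar>det b\<bar> powr (-1/p)) * (2 * N)"
        using e(3) t det_b by (intro mult_left_mono) auto
      finally have cK: "(\<Sum>\<^sub>\<infinity>k. norm (c k) powr p) powr (1/p) \<le> K * N"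
        using cs(2) by (simp add: K_def)
      have ad: "spt (affine_fun a b p \<psi> j k) \<subseteq> \<Omega>" if "c k \<noteq> 0" for k
      proof -
        have "B j *v int_vec k \<in> C" using that g(4) by (auto simp: c_def)
        moreover have "spt (affine_fun a b p \<psi> j k) \<subseteq> cball (B j *v int_vec k) d"
          using spt_affine_fun_subset[OF j1 contr(1), of k] \<eta>'(1) \<eta>'d by force
        ultimately show ?thesis using d(2) by blast
      qed
      have eq: "(\<lambda>k. c k * of_real (weight j)) = (\<lambda>k. of_real t * g (B j *v int_vec k))"
        using w by (simp add: c_def)
      have "AE x in lebesgue. g x - scale_sum a b p \<psi> (\<lambda>_. c) j x = g x - scale_synth (M j) (\<lambda>k. of_real t * g (B j *v int_vec k)) x"
        using scale_sum_AE[OF j1, of "\<lambda>_. c"] unfolding eq by eventually_elim simp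
      then have "Lp_le p (\<lambda>x. g x - scale_sum a b p \<psi> (\<lambda>_. c) j x) (q * (N + e) + e)"
        by (intro Lp_le_cong_AE[OF conjunct2[OF s]])
      from Lp_le_add[OF p g(5) this]
      have "Lp_le p (\<lambda>x. f x - scale_sum a b p \<psi> (\<lambda>_. c) j x) (e + (q * (N + e) + e))"
        by simp
      moreover have "e + (q * (N + e) + e) \<le> L * N"
      proof -
        have "q * e \<le> e" using q e(1) by simp
        then have "e + (q * (N + e) + e) \<le> q * N + 3 * e" by (simp add: algebra_simps)
        also have "\<dots> = L * N" unfolding e(2) by (simp add: L_def field_simps)
        finally show ?thesis .
      qed
      ultimately have "Lp_le p (\<lambda>x. f x - scale_sum a b p \<psi> (\<lambda>_. c) j x) (L * N)"
        by (rule Lp_le_mono) (use p in simp)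
      then have "good_scale L K f j c"
        using j1 cs(1) cK ad by (simp add: good_scale_def N_def)
      then show ?thesis using j by (intro exI[of _ j] exI[of _ c]) auto
    qed
  qed
qed

text \<open>The subtracted synthesis vanishes outside \<Omega>, so the residual is again an
  admissible input for the next step.\<close>

lemma good_scale_residual:
  assumes f: "f \<in> Lp p \<Omega>" and g: "good_scale L K f j c"
  shows "(\<lambda>x. f x - scale_sum a b p \<psi> (\<lambda>_. c) j x) \<in> Lp p \<Omega>"
    "Lp_norm p UNIV (\<lambda>x. f x - scale_sum a b p \<psi> (\<lambda>_. c) j x) \<le> L * Lp_norm p UNIV f"
proof -
  have *: "(\<lambda>x. f x - scale_sum a b p \<psi> (\<lambda>_. c) j x) \<in> Lp p UNIV \<and>
    Lp_norm p UNIV (\<lambda>x. f x - scale_sum a b p \<psi> (\<lambda>_. c) j x) \<le> L * Lp_norm p UNIV f"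
    using g by (simp add: good_scale_def Lp_le_iff[OF p])
  then show "Lp_norm p UNIV (\<lambda>x. f x - scale_sum a b p \<psi> (\<lambda>_. c) j x) \<le> L * Lp_norm p UNIV f" by blast
  have "AE x in lebesgue. x \<notin> \<Omega> \<longrightarrow> scale_sum a b p \<psi> (\<lambda>_. c) j x = 0"
    using g by (intro scale_sum_zero_outside) (simp add: good_scale_def)
  moreover have "AE x in lebesgue. x \<notin> \<Omega> \<longrightarrow> f x = 0"
    using f by (simp add: Lp_def)
  ultimately have "AE x in lebesgue. x \<notin> \<Omega> \<longrightarrow> f x - scale_sum a b p \<psi> (\<lambda>_. c) j x = 0"
    by eventually_elim simp
  with * show "(\<lambda>x. f x - scale_sum a b p \<psi> (\<lambda>_. c) j x) \<in> Lp p \<Omega>"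
    by (simp add: Lp_def)
qed

end

section \<open>Iteration along increasing scales\<close>

lemma step_selection:
  fixes j :: "nat \<Rightarrow> nat"
  assumes j: "strict_mono j" "\<And>n. 1 \<le> j n" and S: "\<And>i. i \<notin> range j \<Longrightarrow> S i = 0"
    and R: "\<And>n. R (Suc n) = R n - S (j n)"
  obtains m where "R 0 - (\<Sum>i=1..J. S i) = (R m :: 'a::ab_group_add)" "J < j m" "\<And>n. n < m \<Longrightarrow> j n \<le> J"
proof -
  have "\<exists>m. R 0 - (\<Sum>i=1..J. S i) = R m \<and> J < j m \<and> (\<forall>n<m. j n \<le> J)"
  proof (induction J)
    case 0
    show ?case
      using j(2)[of 0] by (intro exI[of _ 0]) auto
  next
    case (Suc J)
    then obtain m where m: "R 0 - (\<Sum>i=1..J. S i) = R m" "J < j m" "\<forall>n<m. j n \<le> J" by blast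
    show ?case
    proof (cases "j m = Suc J")
      case True
      have "R 0 - (\<Sum>i=1..Suc J. S i) = R (Suc m)"
        using m(1) R[of m] True by (simp add: algebra_simps)
      moreover have "Suc J < j (Suc m)"
        using strict_monoD[OF j(1), of m "Suc m"] True by simp
      moreover have "\<forall>n<Suc m. j n \<le> Suc J"
        using m(3) True by (auto simp: less_Suc_eq le_SucI)
      ultimately show ?thesis by blast
    next
      case False
      have "Suc J \<notin> range j"
      proof
        assume "Suc J \<in> range j"
        then obtain n where n: "Suc J = j n" by blast
        then have "\<not> n < m" using m(3) by fastforce
        then have "j m \<le> j n" using strict_mono_less_eq[OF j(1), of m n] by simp
        then show False using m(2) n False by simp
      qed
      then have "R 0 - (\<Sum>i=1..Suc J. S i) = R m"
        using m(1) S by simp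
      then show ?thesis
        using m(2,3) False by (intro exI[of _ m]) (auto simp: le_SucI)
    qed
  qed
  then show ?thesis using that by blast
qed

context affine_system
begin

text \<open>The n-th residual has norm at most L^n times that of \<open>f\<close>, and its row of
  coefficients at most \<open>K\<close> times as much; the constant K/(1-L) is the sum of this
  geometric series.\<close>

theorem synthesis_exists:
  obtains K' where "0 < K'"
    "\<And>f. f \<in> Lp p \<Omega> \<Longrightarrow> \<exists>c. c \<in> l1lp p \<and> is_synthesis a b p \<psi> c f \<and> adapted a b p \<psi> \<Omega> c \<and>
       l1lp_norm p c \<le> K' * Lp_norm p UNIV f"
proof -
  obtain L K where L: "0 \<le> L" "L < 1" and K: "0 < K" and
    step: "\<And>f J. f \<in> Lp p \<Omega> \<Longrightarrow> \<exists>j c. J < j \<and> good_scale L K f j c"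
    using one_scale_contraction by metis
  show thesis
  proof (rule that[of "K / (1 - L)"])
    show "0 < K / (1 - L)" using L K by simp
    fix f assume f: "f \<in> Lp p \<Omega>"
    define N where "N = Lp_norm p UNIV f"
    have N: "0 \<le> N" by (simp add: N_def Lp_norm_nonneg)
    let ?res = "\<lambda>g j c. (\<lambda>x. g x - scale_sum a b p \<psi> (\<lambda>_. c) j x)"
    \<comment> \<open>A state holds the current residual, a scale and a row of coefficients that
      contracts it. The clause for n = 0 starts the chain at \<open>f\<close>.\<close>
    define P where "P n s = (case s of (g, j, c) \<Rightarrow> g \<in> Lp p \<Omega> \<and> good_scale L K g j c \<and> (n = 0 \<longrightarrow> g = f))"
      for n :: nat and s :: "(real ^ 'd \<Rightarrow> complex) \<times> nat \<times> (int ^ 'd \<Rightarrow> complex)"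
    define Q where "Q n s s' = (case s of (g, j, c) \<Rightarrow> case s' of (g', j', c') \<Rightarrow> g' = ?res g j c \<and> j < j')"
      for n :: nat and s s' :: "(real ^ 'd \<Rightarrow> complex) \<times> nat \<times> (int ^ 'd \<Rightarrow> complex)"
    have "\<exists>s. \<forall>n. P n (s n) \<and> Q n (s n) (s (Suc n))"
    proof (rule dependent_nat_choice)
      obtain j c where "good_scale L K f j c" using step[OF f] by blast
      then have "P 0 (f, j, c)" using f by (simp add: P_def)
      then show "\<exists>s. P 0 s" ..
    next
      fix s n assume "P n s"
      obtain g j c where s: "s = (g, j, c)" by (cases s) auto
      then have g: "g \<in> Lp p \<Omega>" "good_scale L K g j c" using \<open>P n s\<close> by (auto simp: P_def)
      have r: "?res g j c \<in> Lp p \<Omega>" by (rule good_scale_residual[OF g])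
      obtain j' c' where "j < j'" "good_scale L K (?res g j c) j' c'" using step[OF r] by blast
      then have "P (Suc n) (?res g j c, j', c') \<and> Q n s (?res g j c, j', c')"
        using r by (simp add: P_def Q_def s)
      then show "\<exists>y. P (Suc n) y \<and> Q n s y" ..
    qed
    then obtain s where s: "\<And>n. P n (s n)" "\<And>n. Q n (s n) (s (Suc n))" by blast
    define g where "g n = fst (s n)" for n
    define j where "j n = fst (snd (s n))" for n
    define d where "d n = snd (snd (s n))" for n
    have gL: "g n \<in> Lp p \<Omega>" and good: "good_scale L K (g n) (j n) (d n)" for n
      using s(1)[of n] by (auto simp: P_def g_def j_def d_def split: prod.splits)
    have g0: "g 0 = f"
      using s(1)[of 0] by (auto simp: P_def g_def split: prod.splits)
    have gSuc: "g (Suc n) = ?res (g n) (j n) (d n)" and jSuc: "j n < j (Suc n)" for n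
      using s(2)[of n] by (auto simp: Q_def g_def j_def d_def split: prod.splits)
    have jm: "strict_mono j" by (rule strict_monoI_Suc) (rule jSuc)
    then have inj: "inj j" by (rule strict_mono_imp_inj_on)
    have j1: "1 \<le> j n" for n using good[of n] by (simp add: good_scale_def)
    have gn: "Lp_norm p UNIV (g n) \<le> L ^ n * N" for n
    proof (induction n)
      case 0
      then show ?case by (simp add: g0 N_def)
    next
      case (Suc n)
      have "Lp_norm p UNIV (g (Suc n)) \<le> L * Lp_norm p UNIV (g n)"
        unfolding gSuc by (rule good_scale_residual(2)[OF gL good])
      also have "\<dots> \<le> L * (L ^ n * N)" using Suc L by (intro mult_left_mono)
      finally show ?case by simp
    qed
    \<comment> \<open>The rows are placed at their scales, which are distinct since \<open>j\<close>
      is injective; scales never visited get the zero row.\<close>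
    define c where "c i = (if i \<in> range j then d (inv j i) else (\<lambda>_. 0))" for i
    have cj: "c (j n) = d n" for n by (simp add: c_def inj)
    have c0: "c i = (\<lambda>_. 0)" if "i \<notin> range j" for i using that by (simp add: c_def)
    let ?n = "\<lambda>i. (\<Sum>\<^sub>\<infinity>k. norm (c i k) powr p) powr (1/p)"
    let ?S = "scale_sum a b p \<psi> c"
    have n0: "?n i = 0" if "i \<notin> range j" for i
      by (simp add: c0[OF that])
    have S0: "?S i = (\<lambda>x. 0)" if "i \<notin> range j" for i
      by (simp add: scale_sum_def[abs_def] c0[OF that])
    have Sj: "?S (j n) = scale_sum a b p \<psi> (\<lambda>_. d n) (j n)" for n
      by (simp add: scale_sum_def[abs_def] cj)
    have cs: "(\<lambda>k. norm (c i k) powr p) summable_on UNIV" for i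
    proof (cases "i \<in> range j")
      case True
      then obtain n where "i = j n" by blast
      then show ?thesis using good[of n] by (simp add: cj good_scale_def)
    qed (simp add: c0)
    have bound: "?n (j n) \<le> K * (L ^ n * N)" for n
    proof -
      have "?n (j n) \<le> K * Lp_norm p UNIV (g n)" using good[of n] by (simp add: cj good_scale_def)
      also have "\<dots> \<le> K * (L ^ n * N)" using gn K by (intro mult_left_mono) auto
      finally show ?thesis .
    qed
    have "summable (\<lambda>n. L ^ n)" using L by (intro summable_geometric) simp
    then have geo: "summable (\<lambda>n. K * (L ^ n * N))" by (intro summable_mult summable_mult2)
    have geo_on: "(\<lambda>n. K * (L ^ n * N)) summable_on UNIV"
      using geo L K N by (subst summable_on_UNIV_nonneg_real_iff) auto
    have nj: "(\<lambda>n. ?n (j n)) summable_on UNIV"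
      by (rule summable_on_comparison_test[OF geo_on]) (use bound in auto)
    have iff: "?n summable_on {1..} \<longleftrightarrow> ?n summable_on range j"
      by (rule summable_on_cong_neutral) (use j1 n0 in auto)
    have ns: "?n summable_on {1..}"
      unfolding iff summable_on_reindex[OF inj] using nj by (simp add: o_def)
    have c_l1lp: "c \<in> l1lp p"
      using cs ns by (simp add: l1lp_def)
    have "l1lp_norm p c = (\<Sum>\<^sub>\<infinity>i\<in>range j. ?n i)"
      unfolding l1lp_norm_def by (rule infsum_cong_neutral) (use j1 n0 in auto)
    also have "\<dots> = (\<Sum>\<^sub>\<infinity>n. ?n (j n))"
      by (subst infsum_reindex[OF inj]) (simp add: o_def)
    also have "\<dots> \<le> (\<Sum>\<^sub>\<infinity>n. K * (L ^ n * N))"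
      by (rule infsum_mono[OF nj geo_on bound])
    also have "\<dots> = (\<Sum>n. K * (L ^ n * N))"
      by (rule sums_unique[OF has_sum_imp_sums[OF has_sum_infsum[OF geo_on]]])
    also have "\<dots> = K / (1 - L) * N"
      using L \<open>summable (\<lambda>n. L ^ n)\<close> by (simp add: suminf_mult suminf_mult2[symmetric] suminf_geometric summable_mult2)
    finally have c_norm: "l1lp_norm p c \<le> K / (1 - L) * N" .
    have c_adapted: "adapted a b p \<psi> \<Omega> c"
      unfolding adapted_def
    proof (intro allI impI)
      fix i k assume "c i k \<noteq> 0"
      then have "i \<in> range j" by (auto simp: c_def split: if_splits)
      then obtain n where "i = j n" by blast
      then show "spt (affine_fun a b p \<psi> i k) \<subseteq> \<Omega>"
        using good[of n] \<open>c i k \<noteq> 0\<close> by (simp add: cj good_scale_def)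
    qed
    have SL: "Lp_le p (?S i) (synth_const * ?n i)" if "1 \<le> i" for i
      by (rule Lp_le_scale_sum[OF that cs])
    have partial: "\<exists>m. (\<lambda>x. f x - (\<Sum>i=1..J. ?S i x)) = g m \<and> J < j m" for J
    proof -
      \<comment> \<open>The selection lemma is later applied at each point, giving an index that
        might depend on \<open>x\<close>. Applying it to zero sequences first yields an index free
        of \<open>x\<close>, and the two inequalities determine it uniquely.\<close>
      have "\<exists>m. J < j m \<and> (\<forall>n<m. j n \<le> J)"
        using step_selection[OF jm j1, of "\<lambda>_. 0 :: int" "\<lambda>_. 0" J] by auto
      then obtain m where m: "J < j m" "\<forall>n<m. j n \<le> J" by blast
      have "f x - (\<Sum>i=1..J. ?S i x) = g m x" for x
      proof -
        obtain m' where m': "g 0 x - (\<Sum>i=1..J. ?S i x) = g m' x" "J < j m'" "\<And>n. n < m' \<Longrightarrow> j n \<le> J"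
          using step_selection[OF jm j1, of "\<lambda>i. ?S i x" "\<lambda>n. g n x" J] S0 Sj gSuc by auto
        have "m' = m" using m m'(2,3) by (metis linorder_neqE_nat not_less)
        then show ?thesis using m' g0 by simp
      qed
      then show ?thesis using m(1) by blast
    qed
    have lim: "(\<lambda>J. Lp_norm p UNIV (\<lambda>x. f x - (\<Sum>i=1..J. ?S i x))) \<longlonglongrightarrow> 0"
    proof (rule LIMSEQ_I)
      fix e :: real assume "0 < e"
      have "(\<lambda>n. L ^ n * N) \<longlonglongrightarrow> 0 * N"
        using L by (intro tendsto_mult LIMSEQ_realpow_zero tendsto_const) auto
      then obtain n where n: "L ^ n * N < e"
        using order_tendstoD(2)[of _ "0 * N" sequentially e] \<open>0 < e\<close> by (auto simp: eventually_sequentially)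
      \<comment> \<open>Once \<open>J\<close> passes the n-th scale the remainder is a residual of
        index at least \<open>n\<close>.\<close>
      have "norm (Lp_norm p UNIV (\<lambda>x. f x - (\<Sum>i=1..J. ?S i x)) - 0) < e" if J: "J \<ge> j n" for J
      proof -
        obtain m where m: "(\<lambda>x. f x - (\<Sum>i=1..J. ?S i x)) = g m" "J < j m" using partial by blast
        then have "n \<le> m" using J strict_mono_less[OF jm, of n m] by simp
        then have "L ^ m * N \<le> L ^ n * N"
          using L N by (intro mult_right_mono power_decreasing) auto
        then show ?thesis unfolding m(1) using gn[of m] n by (simp add: Lp_norm_nonneg)
      qed
      then show "\<exists>no. \<forall>J\<ge>no. norm (Lp_norm p UNIV (\<lambda>x. f x - (\<Sum>i=1..J. ?S i x)) - 0) < e" by blast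
    qed
    have "is_synthesis a b p \<psi> c f"
      unfolding is_synthesis_def
    proof (intro conjI allI impI)
      show "f \<in> Lp p UNIV" using f by (simp add: Lp_def)
      show "AE x in lebesgue. (\<lambda>k. norm (c i k * affine_fun a b p \<psi> i k x)) summable_on UNIV" if "1 \<le> i" for i
        using scale_sum_AE[OF that, of c] by eventually_elim simp
      show "?S i \<in> Lp p UNIV" if "1 \<le> i" for i
        using SL[OF that] by (simp add: Lp_le_iff[OF p])
      show "(\<lambda>i. Lp_norm p UNIV (?S i)) summable_on {1..}"
      proof (rule summable_on_comparison_test)
        show "(\<lambda>i. synth_const * ?n i) summable_on {1..}"
          by (rule summable_on_cmult_right[OF ns])
        show "Lp_norm p UNIV (?S i) \<le> synth_const * ?n i" if "i \<in> {1..}" for i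
          using SL[of i] that by (simp add: Lp_le_iff[OF p])
      qed (rule Lp_norm_nonneg)
      show "(\<lambda>J. Lp_norm p UNIV (\<lambda>x. f x - (\<Sum>i=1..J. ?S i x))) \<longlonglongrightarrow> 0" by (rule lim)
    qed
    with c_l1lp c_adapted c_norm
    show "\<exists>c. c \<in> l1lp p \<and> is_synthesis a b p \<psi> c f \<and> adapted a b p \<psi> \<Omega> c \<and>
       l1lp_norm p c \<le> K / (1 - L) * Lp_norm p UNIV f"
      unfolding N_def by blast
  qed
qed

end

text \<open>The infimum is taken in the extended reals, where the empty set has infimum \<infinity>:
  the second inequality therefore includes the existence of an adapted synthesis.\<close>

theorem corollary5:
  fixes a :: "nat \<Rightarrow> real ^ 'd ^ 'd" and b :: "real ^ 'd ^ 'd"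
    and \<Omega> :: "(real ^ 'd) set" and \<psi> :: "real ^ 'd \<Rightarrow> complex" and p :: real
  assumes "\<And>j. j \<ge> 1 \<Longrightarrow> invertible (a j)"
    and "(\<lambda>j. onorm (\<lambda>x. matrix_inv (a j) *v x)) \<longlonglongrightarrow> 0"
    and "invertible b"
    and "open \<Omega>" and "\<Omega> \<noteq> {}"
    and "1 \<le> p"
    and "\<psi> \<in> Lp p UNIV" and "compact (spt \<psi>)"
    and "(LINT x|lebesgue. \<psi> x) = 1"
  shows "\<exists>A>0. \<exists>B>0. \<forall>f\<in>Lp p \<Omega>.
     ereal (Lp_norm p \<Omega> f) \<le>
       ereal A * Inf {ereal (l1lp_norm p c) |c. c \<in> l1lp p \<and> is_synthesis a b p \<psi> c f \<and> adapted a b p \<psi> \<Omega> c} \<and>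
     Inf {ereal (l1lp_norm p c) |c. c \<in> l1lp p \<and> is_synthesis a b p \<psi> c f \<and> adapted a b p \<psi> \<Omega> c}
       \<le> ereal B * ereal (Lp_norm p \<Omega> f)"
proof -
  interpret affine_system a b \<Omega> \<psi> p
    by standard (use assms in auto)
  obtain K where K: "0 < K" and ex: "\<And>f. f \<in> Lp p \<Omega> \<Longrightarrow> \<exists>c. c \<in> l1lp p \<and> is_synthesis a b p \<psi> c f \<and>
      adapted a b p \<psi> \<Omega> c \<and> l1lp_norm p c \<le> K * Lp_norm p UNIV f"
    using synthesis_exists by metis
  \<comment> \<open>Only nonnegativity of \<open>synth_const\<close> has been established, while the
    argument divides by \<open>A\<close>.\<close>
  define A where "A = synth_const + 1"
  have A: "0 < A" using synth_const_nonneg by (simp add: A_def)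
  have "\<forall>f\<in>Lp p \<Omega>.
     ereal (Lp_norm p \<Omega> f) \<le>
       ereal A * Inf {ereal (l1lp_norm p c) |c. c \<in> l1lp p \<and> is_synthesis a b p \<psi> c f \<and> adapted a b p \<psi> \<Omega> c} \<and>
     Inf {ereal (l1lp_norm p c) |c. c \<in> l1lp p \<and> is_synthesis a b p \<psi> c f \<and> adapted a b p \<psi> \<Omega> c}
       \<le> ereal K * ereal (Lp_norm p \<Omega> f)"
  proof (intro ballI conjI)
    fix f assume f: "f \<in> Lp p \<Omega>"
    have N: "Lp_norm p \<Omega> f = Lp_norm p UNIV f"
      using f \<open>open \<Omega>\<close> by (intro Lp_norm_restrict) (auto intro: borel_open)
    let ?X = "{ereal (l1lp_norm p c) |c. c \<in> l1lp p \<and> is_synthesis a b p \<psi> c f \<and> adapted a b p \<psi> \<Omega> c}"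
    have "ereal (Lp_norm p \<Omega> f / A) \<le> Inf ?X"
    proof (rule Inf_greatest)
      fix y assume "y \<in> ?X"
      then obtain c where c: "y = ereal (l1lp_norm p c)" "c \<in> l1lp p" "is_synthesis a b p \<psi> c f" by blast
      have "0 \<le> l1lp_norm p c" unfolding l1lp_norm_def by (rule infsum_nonneg) simp
      then have "Lp_norm p \<Omega> f \<le> l1lp_norm p c * A"
        using synthesis_bound[OF c(2,3)] by (simp add: N A_def algebra_simps)
      then show "ereal (Lp_norm p \<Omega> f / A) \<le> y"
        using A by (simp add: c(1) divide_le_eq)
    qed
    then have "ereal A * ereal (Lp_norm p \<Omega> f / A) \<le> ereal A * Inf ?X"
      using A by (intro ereal_mult_left_mono) auto
    then show "ereal (Lp_norm p \<Omega> f) \<le> ereal A * Inf ?X"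
      using A by simp
    obtain c where c: "c \<in> l1lp p" "is_synthesis a b p \<psi> c f" "adapted a b p \<psi> \<Omega> c"
      "l1lp_norm p c \<le> K * Lp_norm p UNIV f"
      using ex[OF f] by blast
    have "Inf ?X \<le> ereal (l1lp_norm p c)"
      using c(1-3) by (intro Inf_lower) blast
    also have "\<dots> \<le> ereal K * ereal (Lp_norm p \<Omega> f)"
      using c(4) by (simp add: N)
    finally show "Inf ?X \<le> ereal K * ereal (Lp_norm p \<Omega> f)" .
  qed
  with A K show ?thesis by blast
qed

end
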